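(* Let $G=(V,E)$ be an infinite, connected, locally finite, simple undirected graph, let $\kappa^*:E\to\mathbb{R}$ be any function (the prescribed curvature), and let $\omega_0:E\to(0,\infty)$ be any positive function. Then the Ricci flow $$\frac{d}{dt}\omega(t,e)=-(\kappa(t,e)-\kappa^*(e))\,\omega(t,e),\qquad t>0,\ e\in E,$$ with initial value $\omega(0,\cdot)=\omega_0$ admits a solution $\omega(t,e)>0$ on $[0,\infty)$ with $\omega_e:=\omega(\cdot,e)\in C^{1,1}(0,\infty)$ for each $e\in E$. In particular, if $G$ has girth at least $6$, then $\omega_e\in C^\infty(0,\infty)$ for each $e\in E$.
   Context: Lin-Lu-Yau curvature. Let $d(x,y)$ be the combinatorial graph distance. Given positive edge weights $\omega:E\to(0,\infty)$, put $m(x)=\sum_{y\sim x}\omega_{xy}$ and, for $\alpha\in(0,1)$, let $m_x^\alpha$ be the probability measure on $V$ with $m_x^\alpha(x)=\alpha$, $m_x^\alpha(y)=(1-\alpha)\omega_{xy}/m(x)$ for $y\sim x$, and $0$ otherwise. Let $W$ be the $1$-Wasserstein distance with cost $d$. For $x\ne y$, $\kappa(x,y)=\lim_{\alpha\to1^-}\frac{1}{1-\alpha}\left(1-\frac{W(m_x^\alpha,m_y^\alpha)}{d(x,y)}\right)$; for an edge $e=(x,y)$ write $\kappa_e=\kappa(x,y)$. Equivalently, $\kappa(x,y)=\inf\{\nabla_{xy}\Delta f:\ f\text{ is }1\text{-Lipschitz w.r.t. }d,\ \nabla_{yx}f=1\}$, where $\Delta f(x)=\frac1{m(x)}\sum_{z\sim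 x}\omega_{xz}(f(z)-f(x))$ and $\nabla_{xy}f=\frac{f(x)-f(y)}{d(x,y)}$. The distance $d$ is the fixed graph distance and does not depend on $\omega$. In the flow, $\kappa(t,e)$ is the Lin-Lu-Yau curvature of $e$ computed with the edge weights $\omega(t,\cdot)$. A solution is a family of positive functions $\omega(\cdot,e)$, continuous on $[0,\infty)$, satisfying the equation for $t>0$ and the initial condition at $t=0$. The girth of $G$ is the length of a shortest cycle ($\infty$ if there is none); on a graph of girth at least $6$ one has $\kappa_e=2\omega_{xy}\left(\frac1{m(x)}+\frac1{m(y)}\right)-2$ for $e=(x,y)$. $C^{1,1}(0,\infty)$ means continuously differentiable with derivative Lipschitz on every bounded interval $(0,T]$, $T>0$. *)

theory Defs
  imports "HOL-Probability.Probability"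
begin

section \<open>Graphs\<close>

text \<open>An undirected edge joining \<open>x\<close> and \<open>y\<close> is the set \<open>{x, y}\<close>, so a function on edges is
  automatically symmetric in the two endpoints.\<close>

definition simple_graph :: "'a set \<Rightarrow> 'a set set \<Rightarrow> bool" where
  "simple_graph V E \<longleftrightarrow> (\<forall>e\<in>E. e \<subseteq> V \<and> card e = 2)"

definition nbrs :: "'a set set \<Rightarrow> 'a \<Rightarrow> 'a set" where
  "nbrs E x = {y. {x, y} \<in> E}"

definition locally_finite_graph :: "'a set \<Rightarrow> 'a set set \<Rightarrow> bool" where
  "locally_finite_graph V E \<longleftrightarrow> (\<forall>x\<in>V. finite (nbrs E x))"

definition walk_betw :: "'a set set \<Rightarrow> 'a \<Rightarrow> 'a list \<Rightarrow> 'a \<Rightarrow> bool" where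
  "walk_betw E x p y \<longleftrightarrow>
     p \<noteq> [] \<and> hd p = x \<and> last p = y \<and> successively (\<lambda>u v. {u, v} \<in> E) p"

definition connected_graph :: "'a set \<Rightarrow> 'a set set \<Rightarrow> bool" where
  "connected_graph V E \<longleftrightarrow> (\<forall>x\<in>V. \<forall>y\<in>V. \<exists>p. walk_betw E x p y)"

definition graph_dist :: "'a set set \<Rightarrow> 'a \<Rightarrow> 'a \<Rightarrow> nat" where
  "graph_dist E x y = (LEAST n. \<exists>p. walk_betw E x p y \<and> length p = Suc n)"

text \<open>A cycle is given by its distinct vertices in cyclic order, without repeating the first one,
  so that the list length is the number of edges.\<close>

definition is_cycle :: "'a set set \<Rightarrow> 'a list \<Rightarrow> bool" where
  "is_cycle E c \<longleftrightarrow> length c \<ge> 3 \<and> distinct c \<and>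
     successively (\<lambda>u v. {u, v} \<in> E) c \<and> {last c, hd c} \<in> E"

definition girth :: "'a set set \<Rightarrow> enat" where
  "girth E = (INF c\<in>{c. is_cycle E c}. enat (length c))"


section \<open>Lin-Lu-Yau curvature\<close>

definition vertex_weight :: "'a set set \<Rightarrow> ('a set \<Rightarrow> real) \<Rightarrow> 'a \<Rightarrow> real" where
  "vertex_weight E w x = (\<Sum>y\<in>nbrs E x. w {x, y})"

definition lazy_density :: "'a set set \<Rightarrow> ('a set \<Rightarrow> real) \<Rightarrow> real \<Rightarrow> 'a \<Rightarrow> 'a \<Rightarrow> real" where
  "lazy_density E w \<alpha> x z =
     (if z = x then \<alpha>
      else if z \<in> nbrs E x then (1 - \<alpha>) * w {x, z} / vertex_weight E w x
      else 0)"

text \<open>\<open>embed_pmf\<close> is specified only for densities of total mass 1; see \<open>pmf_lazy_measure\<close>.\<close>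

definition lazy_measure :: "'a set set \<Rightarrow> ('a set \<Rightarrow> real) \<Rightarrow> real \<Rightarrow> 'a \<Rightarrow> 'a pmf" where
  "lazy_measure E w \<alpha> x = embed_pmf (lazy_density E w \<alpha> x)"

lemma pmf_lazy_measure:
  assumes E: "simple_graph V E" and fin: "finite (nbrs E x)" and ne: "nbrs E x \<noteq> {}"
    and w: "\<And>e. e \<in> E \<Longrightarrow> 0 < w e" and \<alpha>: "0 < \<alpha>" "\<alpha> < 1"
  shows "pmf (lazy_measure E w \<alpha> x) z = lazy_density E w \<alpha> x z"
proof -
  have x: "x \<notin> nbrs E x"
    using E by (auto simp: simple_graph_def nbrs_def)
  have pos: "0 < vertex_weight E w x"
    unfolding vertex_weight_def using fin ne w by (intro sum_pos) (auto simp: nbrs_def)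
  have nn: "0 \<le> lazy_density E w \<alpha> x u" for u
    using pos \<alpha> w[of "{x, u}"] by (auto simp: lazy_density_def nbrs_def less_imp_le)
  have "(\<Sum>u\<in>nbrs E x. lazy_density E w \<alpha> x u)
      = (\<Sum>u\<in>nbrs E x. (1 - \<alpha>) / vertex_weight E w x * w {x, u})"
    using x by (intro sum.cong) (auto simp: lazy_density_def)
  also have "\<dots> = 1 - \<alpha>"
    using pos by (simp only: sum_distrib_left[symmetric] vertex_weight_def[symmetric]) simp
  finally have s: "(\<Sum>u\<in>insert x (nbrs E x). lazy_density E w \<alpha> x u) = 1"
    using fin x by (simp add: lazy_density_def[of _ _ _ _ x])
  have "(\<integral>\<^sup>+u. ennreal (lazy_density E w \<alpha> x u) \<partial>count_space UNIV)
      = (\<Sum>u\<in>insert x (nbrs E x). ennreal (lazy_density E w \<alpha> x u))"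
    using fin by (intro nn_integral_count_space') (auto simp: lazy_density_def)
  also have "\<dots> = 1"
    using nn s by (subst sum_ennreal) auto
  finally show ?thesis
    unfolding lazy_measure_def using nn by (intro pmf_embed_pmf) auto
qed

definition couplings :: "'a pmf \<Rightarrow> 'a pmf \<Rightarrow> ('a \<times> 'a) pmf set" where
  "couplings \<mu> \<nu> = {\<pi>. map_pmf fst \<pi> = \<mu> \<and> map_pmf snd \<pi> = \<nu>}"

text \<open>Only used for finitely supported measures; their couplings are finitely supported too, so
  all the expectations below are finite sums.\<close>

definition wasserstein1 :: "('a \<Rightarrow> 'a \<Rightarrow> real) \<Rightarrow> 'a pmf \<Rightarrow> 'a pmf \<Rightarrow> real" where
  "wasserstein1 d \<mu> \<nu> =
     (INF \<pi>\<in>couplings \<mu> \<nu>. measure_pmf.expectation \<pi> (\<lambda>(u, v). d u v))"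

definition lly_curvature :: "'a set set \<Rightarrow> ('a set \<Rightarrow> real) \<Rightarrow> 'a \<Rightarrow> 'a \<Rightarrow> real" where
  "lly_curvature E w x y =
     Lim (at_left 1) (\<lambda>\<alpha>. 1 / (1 - \<alpha>) *
       (1 - wasserstein1 (\<lambda>u v. real (graph_dist E u v))
              (lazy_measure E w \<alpha> x) (lazy_measure E w \<alpha> y) / real (graph_dist E x y)))"


section \<open>Ricci flow with prescribed curvature\<close>

text \<open>The equation is required for both orderings of the endpoints of an edge; the two
  requirements coincide because the curvature is symmetric.\<close>

definition ricci_flow_solution ::
  "'a set set \<Rightarrow> ('a set \<Rightarrow> real) \<Rightarrow> ('a set \<Rightarrow> real) \<Rightarrow> (real \<Rightarrow> 'a set \<Rightarrow> real) \<Rightarrow> bool" where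
  "ricci_flow_solution E \<kappa>s \<omega>0 \<omega> \<longleftrightarrow>
     (\<forall>e\<in>E. \<forall>t\<ge>0. \<omega> t e > 0) \<and>
     (\<forall>e\<in>E. continuous_on {0..} (\<lambda>t. \<omega> t e)) \<and>
     (\<forall>e\<in>E. \<omega> 0 e = \<omega>0 e) \<and>
     (\<forall>x y. \<forall>t>0. {x, y} \<in> E \<longrightarrow>
        ((\<lambda>s. \<omega> s {x, y}) has_real_derivative
           - (lly_curvature E (\<omega> t) x y - \<kappa>s {x, y}) * \<omega> t {x, y}) (at t))"

definition C11_pos :: "(real \<Rightarrow> real) \<Rightarrow> bool" where
  "C11_pos f \<longleftrightarrow>
     (\<forall>t>0. f field_differentiable (at t)) \<and>
     continuous_on {0<..} (deriv f) \<and>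
     (\<forall>T>0. \<exists>L. L-lipschitz_on {0<..T} (deriv f))"

definition smooth_pos :: "(real \<Rightarrow> real) \<Rightarrow> bool" where
  "smooth_pos f \<longleftrightarrow> (\<forall>n. \<forall>t>0. ((deriv ^^ n) f) field_differentiable (at t))"

end

theory Submission
  imports Defs
begin

text \<open>In the variables \<open>u e = ln (\<omega> e)\<close> the flow reads \<open>u' e = \<kappa>s e - \<kappa> e\<close>. The curvature of an edge
  depends on finitely many coordinates of \<open>u\<close>, is bounded by \<open>2\<close>, and is Lipschitz in the supremum
  norm of \<open>u\<close> with a constant that does not depend on the vertex degrees: changing \<open>u\<close> by at most
  \<open>\<delta>\<close> multiplies the transition probabilities by factors of at least \<open>exp (- 2 \<delta>)\<close>, so at most a
  fraction \<open>2 \<delta>\<close> of the moving mass has to be rearranged, over a distance of at most \<open>2\<close>. Hence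
  Picard iteration converges coordinatewise on the whole infinite system, and the (unbounded) prescribed
  curvature only contributes the linear term \<open>\<kappa>s e * t\<close>, which cancels in differences of iterates.\<close>

section \<open>Wasserstein distance of finitely supported measures\<close>

text \<open>Neither degrees nor weights are assumed bounded, so in \<open>\<omega>\<close> itself no
  Lipschitz constant is uniform over the edges: a change of size \<delta> matters more the smaller
  the weights are. Transition probabilities react only to ratios of weights, which is why logarithms
  help; they also give positivity for free, and a speed bounded on each edge rules out blow-up in
  finite time. Optimal transport plans are never constructed for the stability estimate: any plan
  for one family of weights is turned into a plan for another by moving its two ends independently.
  As a limit of expressions built from infima, the curvature is in general only known to be
  Lipschitz in \<open>u\<close>, so the equation yields one Lipschitz derivative and no more. For
  girth at least six the transport problem is solved explicitly up to an error that vanishes in the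
  limit; the curvature is then rational in finitely many weights, and the equation itself raises the
  order of differentiability step by step.\<close>

abbreviation transport_cost :: "('a \<Rightarrow> 'a \<Rightarrow> real) \<Rightarrow> ('a \<times> 'a) pmf \<Rightarrow> real" where
  "transport_cost d \<pi> \<equiv> measure_pmf.expectation \<pi> (\<lambda>(u, v). d u v)"

lemma expectation_mono_finite:
  fixes f g :: "'a \<Rightarrow> real"
  assumes "finite (set_pmf p)" "\<And>x. x \<in> set_pmf p \<Longrightarrow> f x \<le> g x"
  shows "measure_pmf.expectation p f \<le> measure_pmf.expectation p g"
  using assms
  by (intro integral_mono_AE integrable_measure_pmf_finite) (auto simp: AE_measure_pmf_iff)

lemma expectation_bind_finite:
  fixes h :: "'b \<Rightarrow> real"
  assumes "finite (set_pmf p)" "\<And>x. x \<in> set_pmf p \<Longrightarrow> finite (set_pmf (f x))"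
  shows "measure_pmf.expectation (bind_pmf p f) h =
         measure_pmf.expectation p (\<lambda>x. measure_pmf.expectation (f x) h)"
  by (simp add: pmf_expectation_bind[OF assms(1,2) order_refl]
      integral_measure_pmf[OF assms(1), of p])

lemma pmf_of_finite_density:
  assumes "finite A" "\<And>z. 0 \<le> g z" "\<And>z. z \<notin> A \<Longrightarrow> g z = 0" "(\<Sum>z\<in>A. g z) = 1"
  shows "\<exists>q. \<forall>z. pmf q z = g z"
proof -
  have "(\<integral>\<^sup>+z. ennreal (g z) \<partial>count_space UNIV) = (\<Sum>z\<in>A. ennreal (g z))"
    using assms by (intro nn_integral_count_space') auto
  also have "\<dots> = 1"
    using assms by (subst sum_ennreal) auto
  finally show ?thesis
    using assms(2) pmf_embed_pmf[of g] by auto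
qed

lemma set_coupling_subset:
  assumes "\<pi> \<in> couplings \<mu> \<nu>"
  shows "set_pmf \<pi> \<subseteq> set_pmf \<mu> \<times> set_pmf \<nu>"
proof -
  have "set_pmf \<mu> = fst ` set_pmf \<pi>" "set_pmf \<nu> = snd ` set_pmf \<pi>"
    using assms by (simp_all add: couplings_def flip: set_map_pmf)
  then show ?thesis using subset_fst_snd[of "set_pmf \<pi>"] by simp
qed

lemma finite_set_coupling:
  assumes "\<pi> \<in> couplings \<mu> \<nu>" "finite (set_pmf \<mu>)" "finite (set_pmf \<nu>)"
  shows "finite (set_pmf \<pi>)"
  using finite_subset[OF set_coupling_subset[OF assms(1)]] assms(2,3) by simp

lemma pair_pmf_coupling: "pair_pmf \<mu> \<nu> \<in> couplings \<mu> \<nu>"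
  by (simp add: couplings_def map_fst_pair_pmf map_snd_pair_pmf)

text \<open>Randomly displacing both ends of a plan yields a plan between the displaced marginals.
  This is how a plan for one choice of weights becomes a plan for another.\<close>

lemma coupling_bind:
  assumes "\<pi> \<in> couplings \<mu> \<nu>" "\<And>u v. Q u v \<in> couplings (K u) (L v)"
  shows "bind_pmf \<pi> (\<lambda>(u, v). Q u v) \<in> couplings (bind_pmf \<mu> K) (bind_pmf \<nu> L)"
proof -
  have "map_pmf fst (bind_pmf \<pi> (\<lambda>(u, v). Q u v)) = bind_pmf \<pi> (\<lambda>z. K (fst z))"
    using assms(2) by (simp add: map_bind_pmf split_beta couplings_def)
  moreover have "map_pmf snd (bind_pmf \<pi> (\<lambda>(u, v). Q u v)) = bind_pmf \<pi> (\<lambda>z. L (snd z))"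
    using assms(2) by (simp add: map_bind_pmf split_beta couplings_def)
  moreover have "\<mu> = map_pmf fst \<pi>" "\<nu> = map_pmf snd \<pi>"
    using assms(1) by (auto simp: couplings_def)
  ultimately show ?thesis
    by (simp add: couplings_def bind_map_pmf)
qed

lemma expectation_coupling_fst:
  fixes f :: "'a \<Rightarrow> real"
  assumes "\<pi> \<in> couplings \<mu> \<nu>"
  shows "measure_pmf.expectation \<pi> (\<lambda>z. f (fst z)) = measure_pmf.expectation \<mu> f"
  using assms by (auto simp: couplings_def)

lemma expectation_coupling_snd:
  fixes f :: "'a \<Rightarrow> real"
  assumes "\<pi> \<in> couplings \<mu> \<nu>"
  shows "measure_pmf.expectation \<pi> (\<lambda>z. f (snd z)) = measure_pmf.expectation \<nu> f"
  using assms by (auto simp: couplings_def)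

text \<open>Weak Kantorovich duality with a remainder \<open>c\<close>: terms in one variable see
  only the marginals. It serves in both directions, with the metric as \<open>c\<close> for lower
  bounds on its cost and as \<open>d\<close> for upper bounds.\<close>

lemma transport_cost_le:
  assumes "\<pi> \<in> couplings \<mu> \<nu>" "finite (set_pmf \<mu>)" "finite (set_pmf \<nu>)"
    and "\<And>u v. u \<in> set_pmf \<mu> \<Longrightarrow> v \<in> set_pmf \<nu> \<Longrightarrow> d u v \<le> a u + b v + c u v"
  shows "transport_cost d \<pi> \<le> measure_pmf.expectation \<mu> a + measure_pmf.expectation \<nu> b
           + transport_cost c \<pi>"
proof -
  have fin: "finite (set_pmf \<pi>)" by (rule finite_set_coupling[OF assms(1-3)])
  note int = integrable_measure_pmf_finite[OF fin]
  have "transport_cost d \<pi>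
      \<le> measure_pmf.expectation \<pi> (\<lambda>z. a (fst z) + b (snd z) + (case z of (u, v) \<Rightarrow> c u v))"
    using fin assms(4) set_coupling_subset[OF assms(1)] by (intro expectation_mono_finite) auto
  also have "\<dots> = measure_pmf.expectation \<pi> (\<lambda>z. a (fst z))
      + measure_pmf.expectation \<pi> (\<lambda>z. b (snd z)) + transport_cost c \<pi>"
    by (simp add: Bochner_Integration.integral_add int)
  finally show ?thesis
    by (simp only: expectation_coupling_fst[OF assms(1)] expectation_coupling_snd[OF assms(1)])
qed

lemma wasserstein1_le:
  assumes "\<pi> \<in> couplings \<mu> \<nu>" "\<And>u v. 0 \<le> d u v"
  shows "wasserstein1 d \<mu> \<nu> \<le> transport_cost d \<pi>"
  unfolding wasserstein1_def using assms
  by (intro cINF_lower bdd_belowI[of _ 0]) (auto intro!: integral_nonneg simp: split_beta)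

text \<open>Lower bounds are proved plan by plan, so no minimising plan has to exist. The product
  plan keeps the set of plans nonempty, as an infimum of reals requires.\<close>

lemma wasserstein1_ge:
  assumes "\<And>\<pi>. \<pi> \<in> couplings \<mu> \<nu> \<Longrightarrow> c \<le> transport_cost d \<pi>"
  shows "c \<le> wasserstein1 d \<mu> \<nu>"
  unfolding wasserstein1_def using assms pair_pmf_coupling by (intro cINF_greatest) blast+

lemma wasserstein1_commute:
  assumes "\<And>u v. d u v = d v u"
  shows "wasserstein1 d \<mu> \<nu> = wasserstein1 d \<nu> \<mu>"
proof -
  have d: "(\<lambda>(u, v). d u v) = (\<lambda>z. d (snd z) (fst z))"
    using assms by auto
  have swap: "map_pmf prod.swap \<pi> \<in> couplings \<nu> \<mu> \<and>
      transport_cost d (map_pmf prod.swap \<pi>) = transport_cost d \<pi>"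
    if "\<pi> \<in> couplings \<mu> \<nu>" for \<mu> \<nu> :: "'a pmf" and \<pi>
    using that by (subst (2) d) (auto simp: couplings_def pmf.map_comp o_def split_beta)
  have "transport_cost d ` couplings \<mu> \<nu> \<subseteq> transport_cost d ` couplings \<nu> \<mu>" for \<mu> \<nu>
  proof (rule image_subsetI)
    fix \<pi> assume "\<pi> \<in> couplings \<mu> \<nu>"
    from swap[OF this] show "transport_cost d \<pi> \<in> transport_cost d ` couplings \<nu> \<mu>"
      by (intro image_eqI[where x = "map_pmf prod.swap \<pi>"]) simp_all
  qed
  from subset_antisym[OF this[of \<mu> \<nu>] this[of \<nu> \<mu>]] show ?thesis
    unfolding wasserstein1_def by simp
qed

section \<open>The graph distance\<close>

locale connected_lf_graph =
  fixes V :: "'a set" and E :: "'a set set"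
  assumes simple: "simple_graph V E"
    and conn: "connected_graph V E"
    and lf: "locally_finite_graph V E"
begin

abbreviation D :: "'a \<Rightarrow> 'a \<Rightarrow> real" where
  "D u v \<equiv> real (graph_dist E u v)"

lemma edgeD: "{x, y} \<in> E \<Longrightarrow> x \<in> V \<and> y \<in> V \<and> x \<noteq> y"
  using simple by (auto simp: simple_graph_def)

lemma nbrs_iff: "y \<in> nbrs E x \<longleftrightarrow> {x, y} \<in> E"
  by (simp add: nbrs_def)

lemma nbrs_in_V: "y \<in> nbrs E x \<Longrightarrow> y \<in> V"
  using edgeD by (auto simp: nbrs_iff)

lemma self_notin_nbrs [simp]: "x \<notin> nbrs E x"
  using edgeD[of x x] by (auto simp: nbrs_iff)

lemma finite_nbrs: "x \<in> V \<Longrightarrow> finite (nbrs E x)"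
  using lf by (simp add: locally_finite_graph_def)

lemma graph_dist_le:
  assumes "walk_betw E x p y"
  shows "Suc (graph_dist E x y) \<le> length p"
proof -
  have "p \<noteq> []" using assms by (simp add: walk_betw_def)
  then have "length p = Suc (length p - 1)" by simp
  then have "graph_dist E x y \<le> length p - 1"
    unfolding graph_dist_def using assms by (intro Least_le) blast
  then show ?thesis using \<open>length p = _\<close> by linarith
qed

lemma shortest_walk:
  assumes "x \<in> V" "y \<in> V"
  obtains p where "walk_betw E x p y" "length p = Suc (graph_dist E x y)"
proof -
  obtain p where "walk_betw E x p y"
    using conn assms by (auto simp: connected_graph_def)
  then have "\<exists>n p. walk_betw E x p y \<and> length p = Suc n"
    by (intro exI[of _ "length p - 1"] exI[of _ p]) (auto simp: walk_betw_def)
  from LeastI_ex[OF this] show ?thesis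
    using that by (auto simp: graph_dist_def)
qed

lemma dist_self: "graph_dist E x x = 0"
  using graph_dist_le[of x "[x]" x] by (simp add: walk_betw_def)

text \<open>Concatenation of shortest walks, dropping the repeated middle vertex. Membership in
  \<open>V\<close> guarantees that such walks exist; without any walk the \<open>LEAST\<close> would
  be unspecified. Supports of measures are therefore tracked inside \<open>V\<close> below.\<close>

lemma dist_triangle:
  assumes "x \<in> V" "y \<in> V" "z \<in> V"
  shows "graph_dist E x z \<le> graph_dist E x y + graph_dist E y z"
proof -
  obtain p where p: "walk_betw E x p y" "length p = Suc (graph_dist E x y)"
    using shortest_walk assms by blast
  obtain q where q: "walk_betw E y q z" "length q = Suc (graph_dist E y z)"
    using shortest_walk assms by blast
  have "walk_betw E x (p @ tl q) z"
    using p(1) q(1)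
    by (cases q) (auto simp: walk_betw_def successively_append_iff successively_Cons last_append)
  from graph_dist_le[OF this] show ?thesis using p q by simp
qed

lemma walk_rev: "walk_betw E x p y \<Longrightarrow> walk_betw E y (rev p) x"
  by (auto simp: walk_betw_def hd_rev last_rev insert_commute)

lemma dist_commute: "graph_dist E x y = graph_dist E y x"
proof -
  have "(\<exists>p. walk_betw E x p y \<and> length p = Suc n)
      \<longleftrightarrow> (\<exists>p. walk_betw E y p x \<and> length p = Suc n)" for n
    using walk_rev by (metis length_rev)
  then show ?thesis unfolding graph_dist_def by simp
qed

lemma dist_zeroD:
  assumes "x \<in> V" "y \<in> V" "graph_dist E x y = 0"
  shows "x = y"
proof -
  obtain p where "walk_betw E x p y" "length p = Suc 0"
    using shortest_walk[OF assms(1,2)] assms(3) by metis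
  then show ?thesis by (auto simp: walk_betw_def length_Suc_conv)
qed

lemma dist_edge: "{x, y} \<in> E \<Longrightarrow> graph_dist E x y = 1"
  using graph_dist_le[of x "[x, y]" y] dist_zeroD[of x y] edgeD[of x y]
  by (cases "graph_dist E x y") (auto simp: walk_betw_def)

lemma D_triangle: "x \<in> V \<Longrightarrow> y \<in> V \<Longrightarrow> z \<in> V \<Longrightarrow> D x z \<le> D x y + D y z"
  using dist_triangle[of x y z] by linarith

end

text \<open>Convexity along segments ending in point masses: one coin decides for both marginals
  whether a given plan is followed or the pair \<open>(x, y)\<close> is taken.\<close>

lemma wasserstein1_mix_return:
  fixes s :: real
  defines "mix \<equiv> \<lambda>\<mu> x. bind_pmf (bernoulli_pmf s) (\<lambda>b. if b then \<mu> else return_pmf x)"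
  assumes s: "0 < s" "s \<le> 1" and fin: "finite (set_pmf \<mu>)" "finite (set_pmf \<nu>)"
    and d: "\<And>u v. 0 \<le> d u v"
  shows "wasserstein1 d (mix \<mu> x) (mix \<nu> y) \<le> s * wasserstein1 d \<mu> \<nu> + (1 - s) * d x y"
proof -
  \<comment> \<open>Solved for the distance on the right, so that it suffices to compare with each
    single plan; this division needs \<open>0 < s\<close>.\<close>
  have "(wasserstein1 d (mix \<mu> x) (mix \<nu> y) - (1 - s) * d x y) / s \<le> wasserstein1 d \<mu> \<nu>"
  proof (rule wasserstein1_ge)
    fix \<pi> assume \<pi>: "\<pi> \<in> couplings \<mu> \<nu>"
    let ?\<pi> = "bind_pmf (bernoulli_pmf s) (\<lambda>b. if b then \<pi> else return_pmf (x, y))"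
    have "?\<pi> \<in> couplings (mix \<mu> x) (mix \<nu> y)"
      using \<pi> unfolding mix_def
      by (auto simp: couplings_def map_bind_pmf intro!: bind_pmf_cong)
    then have "wasserstein1 d (mix \<mu> x) (mix \<nu> y) \<le> transport_cost d ?\<pi>"
      by (rule wasserstein1_le[OF _ d])
    also have "\<dots> = s * transport_cost d \<pi> + (1 - s) * d x y"
      using s finite_set_coupling[OF \<pi> fin] by (subst expectation_bind_finite) auto
    finally show "(wasserstein1 d (mix \<mu> x) (mix \<nu> y) - (1 - s) * d x y) / s
        \<le> transport_cost d \<pi>"
      using s by (simp add: field_simps)
  qed
  then show ?thesis using s by (simp add: field_simps)
qed

lemma transport_cost_const: "transport_cost (\<lambda>u v. c) \<pi> = c"
proof -
  have "transport_cost (\<lambda>u v. c) \<pi> = measure_pmf.expectation \<pi> (\<lambda>z. c)"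
    by (intro Bochner_Integration.integral_cong) auto
  then show ?thesis by simp
qed

section \<open>Existence, bounds and stability of the curvature\<close>

lemma eventually_at_left_1:
  assumes "\<And>\<alpha>. 0 < \<alpha> \<Longrightarrow> \<alpha> < (1::real) \<Longrightarrow> P \<alpha>"
  shows "eventually P (at_left 1)"
  by (rule eventually_mono[OF eventually_at_left_real[of 0 1]]) (auto intro: assms)

definition transition :: "'a set set \<Rightarrow> ('a set \<Rightarrow> real) \<Rightarrow> 'a \<Rightarrow> 'a \<Rightarrow> real" where
  "transition E w x z = (if z \<in> nbrs E x then w {x, z} / vertex_weight E w x else 0)"

section \<open>The lazy random walk and convergence of the curvature quotient\<close>

context connected_lf_graph
begin

text \<open>The edge is a witness that \<open>x\<close> is not isolated and lies in
  \<open>V\<close>, so the sum is nonempty and finite. The same witness recurs in the lemmas on lazy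
  measures.\<close>

lemma vertex_weight_pos:
  assumes "\<forall>e\<in>E. 0 < w e" "{x, y} \<in> E"
  shows "0 < vertex_weight E w x"
  unfolding vertex_weight_def using assms finite_nbrs[of x] edgeD[of x y]
  by (intro sum_pos) (auto simp: nbrs_def)

lemma transition_nonneg:
  assumes "\<forall>e\<in>E. 0 < w e" "{x, y} \<in> E"
  shows "0 \<le> transition E w x z"
  using assms vertex_weight_pos[OF assms] by (auto simp: transition_def nbrs_iff less_imp_le)

lemma sum_transition:
  assumes "\<forall>e\<in>E. 0 < w e" "{x, y} \<in> E"
  shows "(\<Sum>z\<in>nbrs E x. transition E w x z) = 1"
proof -
  have "(\<Sum>z\<in>nbrs E x. transition E w x z) = (\<Sum>z\<in>nbrs E x. w {x, z} / vertex_weight E w x)"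
    by (simp add: transition_def)
  also have "\<dots> = 1"
    using vertex_weight_pos[OF assms]
    by (simp add: sum_divide_distrib[symmetric] vertex_weight_def)
  finally show ?thesis .
qed

context
  fixes w :: "'a set \<Rightarrow> real" and x y :: 'a and \<alpha> :: real
  assumes w: "\<forall>e\<in>E. 0 < w e" and xy: "{x, y} \<in> E" and \<alpha>: "0 < \<alpha>" "\<alpha> < 1"
begin

lemma pmf_lazy: "pmf (lazy_measure E w \<alpha> x) z = (if z = x then \<alpha> else (1 - \<alpha>) * transition E w x z)"
proof -
  have "finite (nbrs E x)" "nbrs E x \<noteq> {}"
    using finite_nbrs edgeD[OF xy] xy by (auto simp: nbrs_def)
  then show ?thesis
    using pmf_lazy_measure[OF simple, of x w \<alpha> z] w \<alpha>
    by (auto simp: lazy_density_def transition_def)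
qed

lemma set_lazy: "set_pmf (lazy_measure E w \<alpha> x) \<subseteq> insert x (nbrs E x)"
  by (auto simp: set_pmf_eq pmf_lazy transition_def)

lemma set_lazy_in_V: "set_pmf (lazy_measure E w \<alpha> x) \<subseteq> V"
  using set_lazy nbrs_in_V edgeD[OF xy] by blast

lemma finite_set_lazy: "finite (set_pmf (lazy_measure E w \<alpha> x))"
  using finite_subset[OF set_lazy] finite_nbrs[of x] edgeD[OF xy] by simp

lemma expectation_lazy:
  fixes g :: "'a \<Rightarrow> real"
  shows "measure_pmf.expectation (lazy_measure E w \<alpha> x) g =
    \<alpha> * g x + (1 - \<alpha>) * (\<Sum>z\<in>nbrs E x. transition E w x z * g z)"
proof -
  have fin: "finite (nbrs E x)" using finite_nbrs edgeD[OF xy] by blast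
  have "measure_pmf.expectation (lazy_measure E w \<alpha> x) g =
      (\<Sum>z\<in>insert x (nbrs E x). pmf (lazy_measure E w \<alpha> x) z * g z)"
    using set_lazy fin by (subst integral_measure_pmf[of "insert x (nbrs E x)"]) auto
  also have "\<dots> = \<alpha> * g x + (\<Sum>z\<in>nbrs E x. pmf (lazy_measure E w \<alpha> x) z * g z)"
    using fin by (simp add: pmf_lazy)
  also have "(\<Sum>z\<in>nbrs E x. pmf (lazy_measure E w \<alpha> x) z * g z)
      = (\<Sum>z\<in>nbrs E x. (1 - \<alpha>) * (transition E w x z * g z))"
    by (intro sum.cong) (auto simp: pmf_lazy)
  finally show ?thesis by (simp add: sum_distrib_left)
qed

text \<open>All moving mass travels distance one. This is the cost of collapsing the lazy measure to
  its centre.\<close>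

lemma expectation_lazy_dist:
  "measure_pmf.expectation (lazy_measure E w \<alpha> x) (\<lambda>u. D x u) = 1 - \<alpha>"
proof -
  have "(\<Sum>z\<in>nbrs E x. transition E w x z * D x z) = (\<Sum>z\<in>nbrs E x. transition E w x z)"
    by (intro sum.cong) (auto simp: nbrs_iff dist_edge)
  then show ?thesis
    by (simp add: expectation_lazy dist_self sum_transition[OF w xy])
qed

end

text \<open>Greater idleness means mixing with the point mass at \<open>x\<close>. The coin's bias
  is forced by the moving mass, which has to shrink from \<open>1 - \<alpha>\<close> to
  \<open>1 - \<beta>\<close>.\<close>

lemma lazy_measure_mix:
  assumes w: "\<forall>e\<in>E. 0 < w e" and xy: "{x, y} \<in> E" and \<alpha>: "0 < \<alpha>" "\<alpha> \<le> \<beta>" "\<beta> < 1"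
  shows "lazy_measure E w \<beta> x = bind_pmf (bernoulli_pmf ((1 - \<beta>) / (1 - \<alpha>)))
    (\<lambda>b. if b then lazy_measure E w \<alpha> x else return_pmf x)"
proof (rule pmf_eqI)
  fix z
  have "(1 - \<alpha>) * ((1 - \<beta>) / (1 - \<alpha>)) = 1 - \<beta>"
    using \<alpha> by simp
  then have "\<beta> = \<alpha> * ((1 - \<beta>) / (1 - \<alpha>)) + (1 - (1 - \<beta>) / (1 - \<alpha>))"
    by (simp only: left_diff_distrib)
  then show "pmf (lazy_measure E w \<beta> x) z = pmf (bind_pmf (bernoulli_pmf ((1 - \<beta>) / (1 - \<alpha>)))
    (\<lambda>b. if b then lazy_measure E w \<alpha> x else return_pmf x)) z"
    using \<alpha> by (auto simp: pmf_bind pmf_lazy[OF w xy])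
qed

definition curvature_quotient :: "('a set \<Rightarrow> real) \<Rightarrow> 'a \<Rightarrow> 'a \<Rightarrow> real \<Rightarrow> real" where
  "curvature_quotient w x y \<alpha> =
     1 / (1 - \<alpha>) * (1 - wasserstein1 D (lazy_measure E w \<alpha> x) (lazy_measure E w \<alpha> y) / D x y)"

text \<open>The Wasserstein distance is convex in \<open>\<alpha>\<close> and equals \<open>D x y\<close> at \<open>\<alpha> = 1\<close>, so the quotient is
  a monotone chord slope; with the bounds below, the limit defining the curvature exists.\<close>

lemma curvature_quotient_mono:
  assumes w: "\<forall>e\<in>E. 0 < w e" and xy: "{x, y} \<in> E" and \<alpha>: "0 < \<alpha>" "\<alpha> \<le> \<beta>" "\<beta> < 1"
  shows "curvature_quotient w x y \<alpha> \<le> curvature_quotient w x y \<beta>"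
proof -
  have yx: "{y, x} \<in> E" using xy by (simp add: insert_commute)
  have \<alpha>1: "\<alpha> < 1" using \<alpha> by simp
  let ?W = "\<lambda>\<alpha>. wasserstein1 D (lazy_measure E w \<alpha> x) (lazy_measure E w \<alpha> y)"
  define s where "s = (1 - \<beta>) / (1 - \<alpha>)"
  have s: "0 < s" "s \<le> 1" "1 - \<beta> = s * (1 - \<alpha>)" using \<alpha> by (auto simp: s_def)
  have "?W \<beta> \<le> s * ?W \<alpha> + (1 - s) * D x y"
    unfolding lazy_measure_mix[OF w xy \<alpha>] lazy_measure_mix[OF w yx \<alpha>] s_def[symmetric]
    using s
    by (intro wasserstein1_mix_return finite_set_lazy[OF w xy] finite_set_lazy[OF w yx] \<alpha> \<alpha>1) auto
  then have "s * (1 - ?W \<alpha>) \<le> 1 - ?W \<beta>"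
    by (simp add: dist_edge[OF xy] algebra_simps)
  then have "s * (1 - ?W \<alpha>) / (s * (1 - \<alpha>)) \<le> (1 - ?W \<beta>) / (s * (1 - \<alpha>))"
    using s \<alpha>1 by (intro divide_right_mono) auto
  then show ?thesis
    using s by (simp add: curvature_quotient_def dist_edge[OF xy])
qed

text \<open>Each lazy measure lies at transport cost \<open>1 - \<alpha>\<close> from its centre and
  the centres are at distance 1, so by the triangle inequality the Wasserstein distance deviates
  from 1 by at most \<open>2 * (1 - \<alpha>)\<close>.\<close>

lemma curvature_quotient_bounds:
  assumes w: "\<forall>e\<in>E. 0 < w e" and xy: "{x, y} \<in> E" and \<alpha>: "0 < \<alpha>" "\<alpha> < 1"
  shows "\<bar>curvature_quotient w x y \<alpha>\<bar> \<le> 2"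
proof -
  have yx: "{y, x} \<in> E" using xy by (simp add: insert_commute)
  let ?\<mu> = "lazy_measure E w \<alpha> x" and ?\<nu> = "lazy_measure E w \<alpha> y"
  note fin = finite_set_lazy[OF w xy \<alpha>] finite_set_lazy[OF w yx \<alpha>]
  note inV = subsetD[OF set_lazy_in_V[OF w xy \<alpha>]] subsetD[OF set_lazy_in_V[OF w yx \<alpha>]]
  note E = expectation_lazy_dist[OF w xy \<alpha>] expectation_lazy_dist[OF w yx \<alpha>]
  note V = edgeD[OF xy]
  have "1 - 2 * (1 - \<alpha>) \<le> wasserstein1 D ?\<mu> ?\<nu>"
  proof (rule wasserstein1_ge)
    fix \<pi> assume \<pi>: "\<pi> \<in> couplings ?\<mu> ?\<nu>"
    have "transport_cost (\<lambda>u v. 1) \<pi> \<le> measure_pmf.expectation ?\<mu> (D x)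
        + measure_pmf.expectation ?\<nu> (D y) + transport_cost D \<pi>"
    proof (rule transport_cost_le[OF \<pi> fin])
      fix u v assume "u \<in> set_pmf ?\<mu>" "v \<in> set_pmf ?\<nu>"
      then show "1 \<le> D x u + D y v + D u v"
        using D_triangle[of x u y] D_triangle[of u v y] inV V dist_edge[OF xy] dist_commute[of v y]
        by (simp add: algebra_simps)
    qed
    then show "1 - 2 * (1 - \<alpha>) \<le> transport_cost D \<pi>" by (simp add: E transport_cost_const)
  qed
  moreover have "wasserstein1 D ?\<mu> ?\<nu> \<le> 1 + 2 * (1 - \<alpha>)"
  proof -
    have "wasserstein1 D ?\<mu> ?\<nu> \<le> transport_cost D (pair_pmf ?\<mu> ?\<nu>)"
      by (intro wasserstein1_le pair_pmf_coupling) auto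
    also have "\<dots> \<le> measure_pmf.expectation ?\<mu> (D x) + measure_pmf.expectation ?\<nu> (D y)
        + transport_cost (\<lambda>u v. 1) (pair_pmf ?\<mu> ?\<nu>)"
    proof (rule transport_cost_le[OF pair_pmf_coupling fin])
      fix u v assume "u \<in> set_pmf ?\<mu>" "v \<in> set_pmf ?\<nu>"
      then show "D u v \<le> D x u + D y v + 1"
        using D_triangle[of u x v] D_triangle[of x y v] inV V dist_edge[OF xy] dist_commute[of u x]
        by (simp add: algebra_simps)
    qed
    finally show ?thesis by (simp add: E transport_cost_const)
  qed
  ultimately show ?thesis
    using \<alpha> unfolding curvature_quotient_def dist_edge[OF xy] abs_le_iff
    by (simp add: field_simps)
qed

text \<open>\<open>Lim\<close> is a definite description, so the definition of the curvature carries
  information only once convergence has been established.\<close>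

lemma lly_curvature_tendsto:
  assumes w: "\<forall>e\<in>E. 0 < w e" and xy: "{x, y} \<in> E"
  shows "(curvature_quotient w x y \<longlongrightarrow> lly_curvature E w x y) (at_left 1)"
proof -
  let ?g = "curvature_quotient w x y"
  \<comment> \<open>Monotonicity is known only for positive \<alpha>, hence the cut with
    \<open>{0<..<1}\<close>; near 1 this does not change the filter.\<close>
  have "(?g \<longlongrightarrow> Sup (?g ` ({..<1} \<inter> {0<..<1}))) (at 1 within ({..<1} \<inter> {0<..<1}))"
    using curvature_quotient_mono[OF w xy] curvature_quotient_bounds[OF w xy]
    by (intro Lim_left_bound[where K = 2]) (auto simp: abs_le_iff)
  moreover have "at 1 within ({..<1} \<inter> {0<..<1}) = at_left (1::real)"
    by (rule at_within_nhd[of _ "{0<..<2}"]) auto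
  ultimately have "\<exists>l. (?g \<longlongrightarrow> l) (at_left 1)" by auto
  moreover have "lly_curvature E w x y = Lim (at_left 1) ?g"
    unfolding lly_curvature_def curvature_quotient_def ..
  ultimately show ?thesis
    using tendsto_Lim[of "at_left (1::real)" ?g] by auto
qed

lemma lly_curvature_bound:
  assumes w: "\<forall>e\<in>E. 0 < w e" and xy: "{x, y} \<in> E"
  shows "\<bar>lly_curvature E w x y\<bar> \<le> 2"
  using curvature_quotient_bounds[OF w xy]
  by (intro tendsto_upperbound[OF tendsto_rabs[OF lly_curvature_tendsto[OF w xy]]]
      eventually_at_left_1) auto

lemma lly_curvature_commute: "lly_curvature E w x y = lly_curvature E w y x"
proof -
  have "wasserstein1 D \<mu> \<nu> = wasserstein1 D \<nu> \<mu>" for \<mu> \<nu> :: "'a pmf"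
    by (rule wasserstein1_commute) (simp add: dist_commute)
  then show ?thesis
    unfolding lly_curvature_def by (subst dist_commute) simp
qed

end

section \<open>Stability of the curvature in the logarithms of the weights\<close>

context connected_lf_graph
begin

text \<open>The numerator loses at most a factor \<open>exp (- \<delta>)\<close> and the normalising
  sum gains at most \<open>exp \<delta>\<close>, however many neighbours there are.\<close>

lemma transition_exp_perturb:
  assumes xy: "{x, y} \<in> E" and u: "\<And>z. {x, z} \<in> E \<Longrightarrow> \<bar>u {x, z} - u' {x, z}\<bar> \<le> \<delta>"
  shows "exp (- (2 * \<delta>)) * transition E (\<lambda>e. exp (u e)) x z \<le> transition E (\<lambda>e. exp (u' e)) x z"
proof (cases "z \<in> nbrs E x")
  case True
  let ?m = "\<lambda>u. vertex_weight E (\<lambda>e. exp (u e)) x"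
  have pos: "0 < ?m u" for u
    using xy by (intro vertex_weight_pos[of _ x y]) auto
  have "?m u' \<le> exp \<delta> * ?m u"
    unfolding vertex_weight_def sum_distrib_left
  proof (rule sum_mono)
    fix z assume "z \<in> nbrs E x"
    then show "exp (u' {x, z}) \<le> exp \<delta> * exp (u {x, z})"
      using u[of z] by (simp add: nbrs_iff abs_le_iff flip: exp_add)
  qed
  moreover have "exp (- \<delta>) * exp (u {x, z}) \<le> exp (u' {x, z})"
    using u[of z] True by (simp add: nbrs_iff abs_le_iff flip: exp_add)
  ultimately have "exp (- \<delta>) * exp (u {x, z}) / (exp \<delta> * ?m u) \<le> exp (u' {x, z}) / ?m u'"
    using pos by (intro frac_le) auto
  moreover have "exp (- (2 * \<delta>)) = exp (- \<delta>) / exp \<delta>"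
    by (simp flip: exp_diff)
  ultimately show ?thesis
    using True by (simp add: transition_def)
qed (simp add: transition_def)

text \<open>By domination the new probabilities are a mixture of the old ones, with weight
  \<open>1 - \<epsilon>\<close>, and a remainder \<open>q\<close>. Only a fraction
  \<open>\<epsilon> \<le> 2 * \<delta>\<close> of the moving mass is resampled, and two neighbours
  of \<open>x\<close> are at distance at most 2, whence \<open>4 * \<delta>\<close>. A kernel,
  unlike a single coupling, can be applied to an end of any given plan.\<close>

lemma lazy_measure_kernel:
  fixes u u' :: "'a set \<Rightarrow> real"
  defines "w \<equiv> \<lambda>e. exp (u e)" and "w' \<equiv> \<lambda>e. exp (u' e)"
  assumes xy: "{x, y} \<in> E" and u: "\<And>z. {x, z} \<in> E \<Longrightarrow> \<bar>u {x, z} - u' {x, z}\<bar> \<le> \<delta>"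
    and \<delta>: "0 < \<delta>" and \<alpha>: "0 < \<alpha>" "\<alpha> < 1"
  obtains K where "bind_pmf (lazy_measure E w \<alpha> x) K = lazy_measure E w' \<alpha> x"
    and "\<And>a. finite (set_pmf (K a))" and "\<And>a. a \<in> V \<Longrightarrow> set_pmf (K a) \<subseteq> V"
    and "measure_pmf.expectation (lazy_measure E w \<alpha> x)
           (\<lambda>a. measure_pmf.expectation (K a) (D a)) \<le> (1 - \<alpha>) * (4 * \<delta>)"
proof -
  have w: "\<forall>e\<in>E. 0 < w e" "\<forall>e\<in>E. 0 < w' e" by (auto simp: w_def w'_def)
  have xV: "x \<in> V" and fin: "finite (nbrs E x)" using edgeD[OF xy] finite_nbrs by auto
  let ?p = "transition E w x" and ?p' = "transition E w' x"
  define \<epsilon> where "\<epsilon> = 1 - exp (- (2 * \<delta>))"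
  have \<epsilon>: "0 < \<epsilon>" "\<epsilon> \<le> 1" "\<epsilon> \<le> 2 * \<delta>" "1 - \<epsilon> = exp (- (2 * \<delta>))"
    using \<delta> exp_ge_add_one_self[of "- (2 * \<delta>)"] by (auto simp: \<epsilon>_def)
  have le: "(1 - \<epsilon>) * ?p z \<le> ?p' z" for z
    unfolding \<epsilon>(4) w_def w'_def by (rule transition_exp_perturb[where u = u and u' = u', OF xy u])
  have out: "?p z = 0" "?p' z = 0" if "z \<notin> nbrs E x" for z
    using that by (auto simp: transition_def)
  \<comment> \<open>The normalised excess of the new probabilities over the retained share of the
    old ones; \<open>0 < \<delta>\<close> gives \<open>0 < \<epsilon>\<close>, so the division is
    legitimate.\<close>
  let ?q = "\<lambda>z. (?p' z - (1 - \<epsilon>) * ?p z) / \<epsilon>"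
  have "0 \<le> ?q z" for z using le \<epsilon> by simp
  moreover have "?q z = 0" if "z \<notin> nbrs E x" for z using out that by simp
  moreover have "(\<Sum>z\<in>nbrs E x. ?q z) = 1"
    using sum_transition[OF w(1) xy] sum_transition[OF w(2) xy] \<epsilon>
    by (simp add: sum_subtractf flip: sum_divide_distrib sum_distrib_left)
  ultimately obtain q where q: "\<And>z. pmf q z = ?q z"
    using pmf_of_finite_density[OF fin, of ?q] by blast
  have qset: "set_pmf q \<subseteq> nbrs E x"
  proof
    fix z assume "z \<in> set_pmf q"
    then show "z \<in> nbrs E x" using out[of z] by (cases "z \<in> nbrs E x") (auto simp: set_pmf_eq q)
  qed
  then have qfin: "finite (set_pmf q)" using fin finite_subset by blast
  \<comment> \<open>The idle mass at \<open>x\<close> is \<alpha> for both families of weights and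
    stays put, so the displacement cost carries the factor \<open>1 - \<alpha>\<close>.\<close>
  define K where "K a = (if a = x then return_pmf x
      else bind_pmf (bernoulli_pmf \<epsilon>) (\<lambda>b. if b then q else return_pmf a))" for a
  have "bind_pmf (lazy_measure E w \<alpha> x) K = lazy_measure E w' \<alpha> x"
  proof (rule pmf_eqI)
    fix z
    have "pmf (bind_pmf (lazy_measure E w \<alpha> x) K) z
        = \<alpha> * pmf (K x) z + (1 - \<alpha>) * (\<Sum>a\<in>nbrs E x. ?p a * pmf (K a) z)"
      by (simp add: pmf_bind expectation_lazy[OF w(1) xy \<alpha>])
    also have "(\<Sum>a\<in>nbrs E x. ?p a * pmf (K a) z)
        = (\<Sum>a\<in>nbrs E x. ?p a * (pmf q z * \<epsilon>) + (if a = z then ?p a * (1 - \<epsilon>) else 0))"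
      using \<epsilon> self_notin_nbrs by (intro sum.cong) (auto simp: K_def pmf_bind algebra_simps)
    also have "\<dots> = pmf q z * \<epsilon> + ?p z * (1 - \<epsilon>)"
      using fin out sum_transition[OF w(1) xy]
      by (auto simp: sum.distrib sum.delta simp flip: sum_distrib_right)
    also have "\<dots> = ?p' z"
      using \<epsilon> by (simp add: q)
    finally show "pmf (bind_pmf (lazy_measure E w \<alpha> x) K) z = pmf (lazy_measure E w' \<alpha> x) z"
      using out by (auto simp: pmf_lazy[OF w(2) xy \<alpha>] K_def[of x])
  qed
  moreover have "finite (set_pmf (K a))" for a
    using qfin by (auto simp: K_def)
  moreover have "set_pmf (K a) \<subseteq> V" if "a \<in> V" for a
    using that qset xV nbrs_in_V by (auto simp: K_def split: if_splits)
  moreover have "measure_pmf.expectation (lazy_measure E w \<alpha> x)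
           (\<lambda>a. measure_pmf.expectation (K a) (D a)) \<le> (1 - \<alpha>) * (4 * \<delta>)"
  proof -
    have "measure_pmf.expectation (K a) (D a) \<le> 4 * \<delta>" if a: "a \<in> nbrs E x" for a
    proof -
      have "D a z \<le> 2" if "z \<in> set_pmf q" for z
        using that qset a D_triangle[of a x z] dist_edge[of x z] dist_edge[of a x] xV
          nbrs_in_V[of z x] nbrs_in_V[of a x]
        by (auto simp: nbrs_iff insert_commute)
      then have "measure_pmf.expectation q (D a) \<le> measure_pmf.expectation q (\<lambda>z. 2)"
        by (intro expectation_mono_finite qfin)
      moreover have "measure_pmf.expectation (K a) (D a) = \<epsilon> * measure_pmf.expectation q (D a)"
        using a \<epsilon> qfin by (auto simp: K_def expectation_bind_finite dist_self)
      ultimately show ?thesis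
        using \<epsilon> mult_mono[of \<epsilon> "2 * \<delta>" "measure_pmf.expectation q (D a)" 2] \<delta>
        by (simp add: integral_nonneg)
    qed
    then have "(\<Sum>a\<in>nbrs E x. ?p a * measure_pmf.expectation (K a) (D a))
        \<le> (\<Sum>a\<in>nbrs E x. ?p a * (4 * \<delta>))"
      using transition_nonneg[OF w(1) xy] by (intro sum_mono mult_left_mono) auto
    also have "\<dots> = 4 * \<delta>"
      using sum_transition[OF w(1) xy] by (simp flip: sum_distrib_right)
    finally show ?thesis
      using \<alpha> by (simp add: expectation_lazy[OF w(1) xy \<alpha>] K_def[of x] dist_self)
  qed
  ultimately show ?thesis using that by blast
qed

text \<open>Both ends of an arbitrary plan are displaced by their kernels. Independent displacement
  suffices because the triangle inequality charges each end separately, \<open>4 * \<delta>\<close>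
  per unit of moving mass. The estimate is one-sided and gets used again with \<open>u\<close> and
  \<open>u'\<close> exchanged.\<close>

lemma wasserstein1_lazy_perturb:
  assumes xy: "{x, y} \<in> E"
    and ux: "\<And>z. {x, z} \<in> E \<Longrightarrow> \<bar>u {x, z} - u' {x, z}\<bar> \<le> \<delta>"
    and uy: "\<And>z. {y, z} \<in> E \<Longrightarrow> \<bar>u {y, z} - u' {y, z}\<bar> \<le> \<delta>"
    and \<delta>: "0 < \<delta>" and \<alpha>: "0 < \<alpha>" "\<alpha> < 1"
  shows "wasserstein1 D (lazy_measure E (\<lambda>e. exp (u' e)) \<alpha> x) (lazy_measure E (\<lambda>e. exp (u' e)) \<alpha> y)
    \<le> wasserstein1 D (lazy_measure E (\<lambda>e. exp (u e)) \<alpha> x) (lazy_measure E (\<lambda>e. exp (u e)) \<alpha> y)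
      + (1 - \<alpha>) * (8 * \<delta>)"
proof -
  have yx: "{y, x} \<in> E" using xy by (simp add: insert_commute)
  have w: "\<forall>e\<in>E. 0 < exp (u e)" by simp
  let ?\<mu> = "lazy_measure E (\<lambda>e. exp (u e)) \<alpha> x" and ?\<nu> = "lazy_measure E (\<lambda>e. exp (u e)) \<alpha> y"
  let ?\<mu>' = "lazy_measure E (\<lambda>e. exp (u' e)) \<alpha> x" and ?\<nu>' = "lazy_measure E (\<lambda>e. exp (u' e)) \<alpha> y"
  note fin = finite_set_lazy[OF w xy \<alpha>] finite_set_lazy[OF w yx \<alpha>]
  note inV = subsetD[OF set_lazy_in_V[OF w xy \<alpha>]] subsetD[OF set_lazy_in_V[OF w yx \<alpha>]]
  obtain K where K: "bind_pmf ?\<mu> K = ?\<mu>'" "\<And>a. finite (set_pmf (K a))"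
      "\<And>a. a \<in> V \<Longrightarrow> set_pmf (K a) \<subseteq> V"
      "measure_pmf.expectation ?\<mu> (\<lambda>a. measure_pmf.expectation (K a) (D a)) \<le> (1 - \<alpha>) * (4 * \<delta>)"
    by (rule lazy_measure_kernel[where u = u and u' = u', OF xy ux \<delta> \<alpha>]) blast+
  obtain L where L: "bind_pmf ?\<nu> L = ?\<nu>'" "\<And>a. finite (set_pmf (L a))"
      "\<And>a. a \<in> V \<Longrightarrow> set_pmf (L a) \<subseteq> V"
      "measure_pmf.expectation ?\<nu> (\<lambda>a. measure_pmf.expectation (L a) (D a)) \<le> (1 - \<alpha>) * (4 * \<delta>)"
    by (rule lazy_measure_kernel[where u = u and u' = u', OF yx uy \<delta> \<alpha>]) blast+
  have "wasserstein1 D ?\<mu>' ?\<nu>' - (1 - \<alpha>) * (8 * \<delta>) \<le> wasserstein1 D ?\<mu> ?\<nu>"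
  proof (rule wasserstein1_ge)
    fix \<pi> assume \<pi>: "\<pi> \<in> couplings ?\<mu> ?\<nu>"
    let ?Q = "\<lambda>a b. pair_pmf (K a) (L b)"
    have "bind_pmf \<pi> (\<lambda>(a, b). ?Q a b) \<in> couplings ?\<mu>' ?\<nu>'"
      using coupling_bind[OF \<pi> pair_pmf_coupling, of K L] K(1) L(1) by simp
    then have "wasserstein1 D ?\<mu>' ?\<nu>' \<le> transport_cost D (bind_pmf \<pi> (\<lambda>(a, b). ?Q a b))"
      by (rule wasserstein1_le) simp
    also have "\<dots> = transport_cost (\<lambda>a b. transport_cost D (?Q a b)) \<pi>"
      using finite_set_coupling[OF \<pi> fin] K(2) L(2)
      by (subst expectation_bind_finite)
        (auto intro!: Bochner_Integration.integral_cong simp: split_beta)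
    also have "\<dots> \<le> measure_pmf.expectation ?\<mu> (\<lambda>a. measure_pmf.expectation (K a) (D a))
        + measure_pmf.expectation ?\<nu> (\<lambda>b. measure_pmf.expectation (L b) (D b))
        + transport_cost D \<pi>"
    proof (rule transport_cost_le[OF \<pi> fin])
      fix a b assume "a \<in> set_pmf ?\<mu>" "b \<in> set_pmf ?\<nu>"
      then have ab: "a \<in> V" "b \<in> V" using inV by auto
      have "transport_cost D (?Q a b) \<le> measure_pmf.expectation (K a) (D a)
          + measure_pmf.expectation (L b) (D b) + transport_cost (\<lambda>_ _. D a b) (?Q a b)"
      proof (rule transport_cost_le[OF pair_pmf_coupling K(2) L(2)])
        fix a' b' assume "a' \<in> set_pmf (K a)" "b' \<in> set_pmf (L b)"
        then have "a' \<in> V" "b' \<in> V" using K(3)[OF ab(1)] L(3)[OF ab(2)] by auto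
        then show "D a' b' \<le> D a a' + D b b' + D a b"
          using ab D_triangle[of a' a b'] D_triangle[of a b b'] dist_commute[of a' a] by simp
      qed
      then show "transport_cost D (?Q a b) \<le> measure_pmf.expectation (K a) (D a)
          + measure_pmf.expectation (L b) (D b) + D a b"
        by (simp only: transport_cost_const)
    qed
    finally show "wasserstein1 D ?\<mu>' ?\<nu>' - (1 - \<alpha>) * (8 * \<delta>) \<le> transport_cost D \<pi>"
      using K(4) L(4) by (simp add: algebra_simps)
  qed
  then show ?thesis by simp
qed

text \<open>The error in the Wasserstein distance is proportional to \<open>1 - \<alpha>\<close>,
  exactly the normalisation in the quotient, so the bound is uniform in \<alpha> and survives the
  limit.\<close>

lemma lly_curvature_exp_lipschitz:
  assumes xy: "{x, y} \<in> E"
    and ux: "\<And>z. {x, z} \<in> E \<Longrightarrow> \<bar>u {x, z} - u' {x, z}\<bar> \<le> \<delta>"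
    and uy: "\<And>z. {y, z} \<in> E \<Longrightarrow> \<bar>u {y, z} - u' {y, z}\<bar> \<le> \<delta>"
    and \<delta>: "0 < \<delta>"
  shows "\<bar>lly_curvature E (\<lambda>e. exp (u e)) x y - lly_curvature E (\<lambda>e. exp (u' e)) x y\<bar> \<le> 8 * \<delta>"
proof (rule tendsto_upperbound)
  let ?g = "\<lambda>u. curvature_quotient (\<lambda>e. exp (u e)) x y"
  show "((\<lambda>\<alpha>. \<bar>?g u \<alpha> - ?g u' \<alpha>\<bar>) \<longlongrightarrow>
      \<bar>lly_curvature E (\<lambda>e. exp (u e)) x y - lly_curvature E (\<lambda>e. exp (u' e)) x y\<bar>) (at_left 1)"
    by (intro tendsto_rabs tendsto_diff lly_curvature_tendsto xy) auto
  show "\<forall>\<^sub>F \<alpha> in at_left 1. \<bar>?g u \<alpha> - ?g u' \<alpha>\<bar> \<le> 8 * \<delta>"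
  proof (rule eventually_at_left_1)
    fix \<alpha> :: real assume \<alpha>: "0 < \<alpha>" "\<alpha> < 1"
    let ?W = "\<lambda>u. wasserstein1 D (lazy_measure E (\<lambda>e. exp (u e)) \<alpha> x)
                    (lazy_measure E (\<lambda>e. exp (u e)) \<alpha> y)"
    have "?W u' \<le> ?W u + (1 - \<alpha>) * (8 * \<delta>)"
      by (rule wasserstein1_lazy_perturb[where u = u and u' = u', OF xy ux uy \<delta> \<alpha>])
    moreover have "?W u \<le> ?W u' + (1 - \<alpha>) * (8 * \<delta>)"
      using ux uy by (intro wasserstein1_lazy_perturb[where u = u' and u' = u, OF xy _ _ \<delta> \<alpha>])
        (simp_all add: abs_minus_commute)
    ultimately have "\<bar>?W u' - ?W u\<bar> \<le> (1 - \<alpha>) * (8 * \<delta>)" by linarith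
    moreover have "?g u \<alpha> - ?g u' \<alpha> = (?W u' - ?W u) / (1 - \<alpha>)"
      by (simp add: curvature_quotient_def dist_edge[OF xy] diff_divide_distrib)
    ultimately show "\<bar>?g u \<alpha> - ?g u' \<alpha>\<bar> \<le> 8 * \<delta>"
      using \<alpha> by (simp add: abs_divide pos_divide_le_eq mult.commute)
  qed
qed simp

end

section \<open>The curvature on graphs of girth at least six\<close>

text \<open>A Kantorovich potential for the edge: 3, 2, 1, 0 along a path from another neighbour of
  \<open>x\<close> through \<open>x\<close> and \<open>y\<close> to another neighbour of
  \<open>y\<close>. The order of the tests matters, since \<open>y\<close> is itself a neighbour of
  \<open>x\<close>.\<close>

definition potential :: "'a set set \<Rightarrow> 'a \<Rightarrow> 'a \<Rightarrow> 'a \<Rightarrow> real" where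
  "potential E x y u = (if u = x then 2 else if u = y then 1 else if u \<in> nbrs E x then 3 else 0)"

context connected_lf_graph
begin

lemma dist_le_2E:
  assumes "a \<in> V" "b \<in> V" "graph_dist E a b \<le> 2"
  obtains "a = b" | "{a, b} \<in> E" | s where "{a, s} \<in> E" "{s, b} \<in> E"
proof -
  obtain p where p: "walk_betw E a p b" "length p = Suc (graph_dist E a b)"
    using shortest_walk assms by blast
  then have "length p = 1 \<or> length p = 2 \<or> length p = 3"
    using assms(3) by linarith
  then show ?thesis
  proof (elim disjE)
    assume "length p = 1"
    then show ?thesis using p(1) that(1) by (auto simp: walk_betw_def length_Suc_conv)
  next
    assume "length p = 2"
    then show ?thesis
      using p(1) that(2) by (auto simp: walk_betw_def length_Suc_conv numeral_2_eq_2)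
  next
    assume "length p = 3"
    then show ?thesis
      using p(1) that(3) by (auto simp: walk_betw_def length_Suc_conv numeral_3_eq_3)
  qed
qed

lemma no_short_cycle:
  assumes "6 \<le> girth E" "length c \<le> 5"
  shows "\<not> is_cycle E c"
proof
  assume "is_cycle E c"
  then have "girth E \<le> enat (length c)"
    unfolding girth_def by (intro INF_lower) simp
  with assms(1) have "6 \<le> enat (length c)" by (rule order_trans)
  then show False using assms(2) by (simp add: numeral_eq_enat)
qed

context
  fixes x y :: 'a
  assumes girth: "6 \<le> girth E" and xy: "{x, y} \<in> E"
begin

lemma no_triangle: "\<not> ({x, z} \<in> E \<and> {y, z} \<in> E)"
  using no_short_cycle[OF girth, of "[x, y, z]"] xy edgeD[of x y] edgeD[of x z] edgeD[of y z]
  by (auto simp: is_cycle_def insert_commute)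

text \<open>Distance 0, 1 or 2 between \<open>z\<close> and \<open>v\<close> would close the path
  \<open>z, x, y, v\<close> to a cycle of length 3, 4 or 5. The last case is what calls for girth
  six.\<close>

lemma dist_across_ge_3:
  assumes "{x, z} \<in> E" "z \<noteq> y" "{y, v} \<in> E" "v \<noteq> x"
  shows "3 \<le> graph_dist E z v"
proof (rule ccontr)
  assume "\<not> 3 \<le> graph_dist E z v"
  then have le: "graph_dist E z v \<le> 2" by simp
  note V = edgeD[OF xy] edgeD[OF assms(1)] edgeD[OF assms(3)]
  from V have "z \<in> V" "v \<in> V" by auto
  then show False using le
  proof (cases rule: dist_le_2E)
    case 1
    then show ?thesis using no_triangle[of z] assms by simp
  next
    case 2
    then show ?thesis
      using no_short_cycle[OF girth, of "[z, x, y, v]"] assms xy V edgeD[OF 2] 2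
      by (simp add: is_cycle_def insert_commute)
  next
    case (3 s)
    \<comment> \<open>The pentagon must have distinct vertices: a midpoint equal to \<open>x\<close>
      or \<open>y\<close> would already give a triangle on the edge.\<close>
    have "s \<noteq> x" "s \<noteq> y"
      using 3 no_triangle[of v] no_triangle[of z] assms by (auto simp: insert_commute)
    moreover have "z \<noteq> v"
      using no_triangle[of z] assms by auto
    ultimately show ?thesis
      using no_short_cycle[OF girth, of "[z, x, y, v, s]"] assms xy V 3 edgeD[OF 3(1)] edgeD[OF 3(2)]
      by (simp add: is_cycle_def insert_commute) blast
  qed
qed

lemma dist_opposite_ge_2: "{x, z} \<in> E \<Longrightarrow> z \<noteq> y \<Longrightarrow> 2 \<le> graph_dist E z y"
proof (rule ccontr)
  assume z: "{x, z} \<in> E" "z \<noteq> y" and "\<not> 2 \<le> graph_dist E z y"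
  then have "graph_dist E z y = 1"
    using dist_zeroD[of z y] edgeD[OF xy] edgeD[OF z(1)] by (cases "graph_dist E z y") auto
  moreover obtain p where "walk_betw E z p y" "length p = Suc (graph_dist E z y)"
    by (rule shortest_walk[of z y]) (use edgeD[OF xy] edgeD[OF z(1)] in auto)
  ultimately have "walk_betw E z p y" "length p = 2"
    by simp_all
  then have "{z, y} \<in> E"
    by (auto simp: walk_betw_def length_Suc_conv numeral_2_eq_2)
  then show False using no_triangle[of z] z by (simp add: insert_commute)
qed

end

text \<open>The Lipschitz condition on the pairs that a plan can charge, which is all that weak
  duality needs. Absence of triangles ensures that other neighbours of \<open>y\<close> receive the
  value 0 and not 3.\<close>

lemma potential_diff_le:
  assumes girth: "6 \<le> girth E" and xy: "{x, y} \<in> E"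
    and u: "u \<in> insert x (nbrs E x)" and v: "v \<in> insert y (nbrs E y)"
  shows "potential E x y u - potential E x y v \<le> D u v"
proof -
  have yx: "{y, x} \<in> E" using xy by (simp add: insert_commute)
  have u': "u = x \<or> u = y \<or> u \<noteq> x \<and> u \<noteq> y \<and> {x, u} \<in> E"
   and v': "v = y \<or> v = x \<or> v \<noteq> x \<and> v \<noteq> y \<and> {y, v} \<in> E \<and> {x, v} \<notin> E"
    using u v no_triangle[OF girth xy, of v] by (auto simp: nbrs_iff)
  show ?thesis
    using u' v'
  proof (elim disjE)
    assume u: "u \<noteq> x \<and> u \<noteq> y \<and> {x, u} \<in> E" and v: "v \<noteq> x \<and> v \<noteq> y \<and> {y, v} \<in> E \<and> {x, v} \<notin> E"
    have "3 \<le> graph_dist E u v" using dist_across_ge_3[OF girth xy, of u v] u v by blast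
    then show ?thesis using u v by (simp add: potential_def nbrs_iff)
  next
    assume u: "u \<noteq> x \<and> u \<noteq> y \<and> {x, u} \<in> E" and v: "v = y"
    have "2 \<le> graph_dist E u v" using dist_opposite_ge_2[OF girth xy, of u] u v by blast
    then show ?thesis using u v edgeD[OF yx] by (simp add: potential_def nbrs_iff)
  next
    assume v: "v \<noteq> x \<and> v \<noteq> y \<and> {y, v} \<in> E \<and> {x, v} \<notin> E" and u: "u = x"
    have "2 \<le> graph_dist E v u" using dist_opposite_ge_2[OF girth yx, of v] u v by blast
    then show ?thesis using u v by (simp add: potential_def nbrs_iff dist_commute[of x v])
  qed (use edgeD[OF xy] edgeD[OF yx] dist_edge[of x y] dist_edge[of y x] dist_edge[of x u]
        dist_edge[of y v] dist_commute[of x u] xy yx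
      in \<open>simp_all add: potential_def nbrs_iff dist_self\<close>)
qed

text \<open>All shortest paths between the two supports run along the potential, except from \<open>y\<close>
  to \<open>x\<close>. The product coupling transports that way only a mass of order \<open>(1 - \<alpha>)\<^sup>2\<close>, which does
  not contribute to the limit.\<close>

lemma dist_le_potential_diff:
  assumes girth: "6 \<le> girth E" and xy: "{x, y} \<in> E"
    and u: "u \<in> insert x (nbrs E x)" and v: "v \<in> insert y (nbrs E y)"
  shows "D u v \<le> potential E x y u - potential E x y v + (if u = y \<and> v = x then 2 else 0)"
proof -
  have yx: "{y, x} \<in> E" using xy by (simp add: insert_commute)
  note V = edgeD[OF xy] edgeD[OF yx]
  have uV: "u \<in> V" and vV: "v \<in> V" using u v V nbrs_in_V by auto
  have u': "u = x \<or> u = y \<or> u \<noteq> x \<and> u \<noteq> y \<and> {x, u} \<in> E \<and> D x u = 1 \<and> D u x = 1"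
   and v': "v = y \<or> v = x \<or> v \<noteq> x \<and> v \<noteq> y \<and> {y, v} \<in> E \<and> {x, v} \<notin> E \<and> D y v = 1"
    using u v no_triangle[OF girth xy, of v] dist_edge[of x u] dist_commute[of x u] dist_edge[of y v]
    by (auto simp: nbrs_iff)
  have "D x y = 1" "D y x = 1" using dist_edge xy yx by simp_all
  moreover have "D u v \<le> D u x + D x v" "D x v \<le> D x y + D y v" "D u y \<le> D u x + D x y"
    using D_triangle uV vV V by auto
  ultimately show ?thesis
    using u' v' V by (elim disjE) (simp_all add: potential_def nbrs_iff dist_self)
qed

lemma expectation_potential:
  assumes w: "\<forall>e\<in>E. 0 < w e" and girth: "6 \<le> girth E" and xy: "{x, y} \<in> E"
    and \<alpha>: "0 < \<alpha>" "\<alpha> < 1"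
  shows "measure_pmf.expectation (lazy_measure E w \<alpha> x) (potential E x y)
      = 2 * \<alpha> + (1 - \<alpha>) * (3 - 2 * transition E w x y)"
    and "measure_pmf.expectation (lazy_measure E w \<alpha> y) (potential E x y)
      = \<alpha> + (1 - \<alpha>) * (2 * transition E w y x)"
proof -
  have yx: "{y, x} \<in> E" using xy by (simp add: insert_commute)
  note V = edgeD[OF xy] edgeD[OF yx]
  note fin = finite_nbrs[of x] finite_nbrs[of y]
  have "(\<Sum>z\<in>nbrs E x. transition E w x z * potential E x y z)
      = (\<Sum>z\<in>nbrs E x. 3 * transition E w x z - (if z = y then 2 * transition E w x z else 0))"
    using V by (intro sum.cong) (auto simp: potential_def)
  also have "\<dots> = 3 - 2 * transition E w x y"
    using sum_transition[OF w xy] fin V xy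
    by (simp add: sum_subtractf sum.delta nbrs_iff flip: sum_distrib_left)
  finally show "measure_pmf.expectation (lazy_measure E w \<alpha> x) (potential E x y)
      = 2 * \<alpha> + (1 - \<alpha>) * (3 - 2 * transition E w x y)"
    by (simp add: expectation_lazy[OF w xy \<alpha>] potential_def[of E x y x])
  have "(\<Sum>z\<in>nbrs E y. transition E w y z * potential E x y z)
      = (\<Sum>z\<in>nbrs E y. if z = x then 2 * transition E w y z else 0)"
    using V no_triangle[OF girth xy] edgeD[of y y]
    by (intro sum.cong) (auto simp: potential_def nbrs_iff)
  also have "\<dots> = 2 * transition E w y x"
    using fin V yx by (simp add: sum.delta nbrs_iff)
  finally show "measure_pmf.expectation (lazy_measure E w \<alpha> y) (potential E x y)
      = \<alpha> + (1 - \<alpha>) * (2 * transition E w y x)"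
    using V by (simp add: expectation_lazy[OF w yx \<alpha>] potential_def[of E x y y])
qed

text \<open>Duality bounds the quotient above by \<open>2 * p + 2 * q - 2\<close>, and the product
  plan bounds it below by the same value minus \<open>2 * p * q * (1 - \<alpha>)\<close>. The plan
  may fail to be optimal for each \<alpha>; its defect disappears in the limit.\<close>

lemma lly_curvature_girth_6:
  assumes w: "\<forall>e\<in>E. 0 < w e" and girth: "6 \<le> girth E" and xy: "{x, y} \<in> E"
  shows "lly_curvature E w x y
    = 2 * w {x, y} * (1 / vertex_weight E w x + 1 / vertex_weight E w y) - 2"
proof -
  have yx: "{y, x} \<in> E" using xy by (simp add: insert_commute)
  note V = edgeD[OF xy] edgeD[OF yx]
  define p where "p = transition E w x y"
  define q where "q = transition E w y x"
  have bounds: "2 * p + 2 * q - 2 - 2 * p * q * (1 - \<alpha>) \<le> curvature_quotient w x y \<alpha> \<and>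
      curvature_quotient w x y \<alpha> \<le> 2 * p + 2 * q - 2" if \<alpha>: "0 < \<alpha>" "\<alpha> < 1" for \<alpha>
  proof -
    let ?\<mu> = "lazy_measure E w \<alpha> x" and ?\<nu> = "lazy_measure E w \<alpha> y"
    let ?f = "potential E x y"
    note fin = finite_set_lazy[OF w xy \<alpha>] finite_set_lazy[OF w yx \<alpha>]
    note supp = subsetD[OF set_lazy[OF w xy \<alpha>]] subsetD[OF set_lazy[OF w yx \<alpha>]]
    note E = expectation_potential[OF w girth xy \<alpha>, folded p_def q_def]
    have lower: "1 + (1 - \<alpha>) * (2 - 2 * p - 2 * q) \<le> wasserstein1 D ?\<mu> ?\<nu>"
    proof (rule wasserstein1_ge)
      fix \<pi> assume \<pi>: "\<pi> \<in> couplings ?\<mu> ?\<nu>"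
      have "transport_cost (\<lambda>u v. 0) \<pi> \<le> measure_pmf.expectation ?\<mu> (\<lambda>u. - ?f u)
          + measure_pmf.expectation ?\<nu> ?f + transport_cost D \<pi>"
        using potential_diff_le[OF girth xy supp]
        by (intro transport_cost_le[OF \<pi> fin]) (simp add: algebra_simps)
      then show "1 + (1 - \<alpha>) * (2 - 2 * p - 2 * q) \<le> transport_cost D \<pi>"
        by (simp add: E transport_cost_const algebra_simps)
    qed
    \<comment> \<open>From \<open>y\<close> to \<open>x\<close> the potential difference is -1 while
      the distance is 1, hence the correction 2. The product plan charges this pair with the product
      of two masses of order \<open>1 - \<alpha>\<close>.\<close>
    let ?c = "\<lambda>u v. if u = y \<and> v = x then 2 else 0 :: real"
    have "wasserstein1 D ?\<mu> ?\<nu> \<le> transport_cost D (pair_pmf ?\<mu> ?\<nu>)"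
      by (intro wasserstein1_le pair_pmf_coupling) auto
    also have "\<dots> \<le> measure_pmf.expectation ?\<mu> ?f + measure_pmf.expectation ?\<nu> (\<lambda>v. - ?f v)
        + transport_cost ?c (pair_pmf ?\<mu> ?\<nu>)"
      using dist_le_potential_diff[OF girth xy supp]
      by (intro transport_cost_le[OF pair_pmf_coupling fin]) simp
    also have "transport_cost ?c (pair_pmf ?\<mu> ?\<nu>) = 2 * (((1 - \<alpha>) * p) * ((1 - \<alpha>) * q))"
      using V by (subst integral_measure_pmf[of "{(y, x)}"])
        (auto simp: pmf_pair pmf_lazy[OF w xy \<alpha>] pmf_lazy[OF w yx \<alpha>] p_def q_def split: if_splits)
    finally have upper: "wasserstein1 D ?\<mu> ?\<nu>
        \<le> 1 + (1 - \<alpha>) * (2 - 2 * p - 2 * q + 2 * p * q * (1 - \<alpha>))"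
      by (simp add: E algebra_simps)
    have quot: "curvature_quotient w x y \<alpha> = (1 - wasserstein1 D ?\<mu> ?\<nu>) / (1 - \<alpha>)"
      by (simp add: curvature_quotient_def dist_edge[OF xy])
    have "(2 * p + 2 * q - 2 - 2 * p * q * (1 - \<alpha>)) * (1 - \<alpha>) \<le> 1 - wasserstein1 D ?\<mu> ?\<nu>"
      using upper by (simp add: algebra_simps)
    moreover have "1 - wasserstein1 D ?\<mu> ?\<nu> \<le> (2 * p + 2 * q - 2) * (1 - \<alpha>)"
      using lower by (simp add: algebra_simps)
    ultimately show ?thesis
      using \<alpha> by (simp add: quot pos_le_divide_eq pos_divide_le_eq)
  qed
  have "(curvature_quotient w x y \<longlongrightarrow> 2 * p + 2 * q - 2) (at_left 1)"
  proof (rule tendsto_sandwich)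
    show "((\<lambda>\<alpha>. 2 * p + 2 * q - 2 - 2 * p * q * (1 - \<alpha>)) \<longlongrightarrow> 2 * p + 2 * q - 2) (at_left 1)"
      by (auto intro!: tendsto_eq_intros)
    show "((\<lambda>\<alpha>. 2 * p + 2 * q - 2) \<longlongrightarrow> 2 * p + 2 * q - 2) (at_left (1::real))"
      by (rule tendsto_const)
  qed (use bounds in \<open>auto intro!: eventually_at_left_1\<close>)
  then have "lly_curvature E w x y = 2 * p + 2 * q - 2"
    using tendsto_unique[OF _ lly_curvature_tendsto[OF w xy]] by auto
  then show ?thesis
    using xy yx by (simp add: p_def q_def transition_def nbrs_iff insert_commute algebra_simps)
qed

end

section \<open>Infinite systems of differential equations with finite local dependence\<close>

text \<open>Derivatives are taken within the half-line so that the endpoint 0 is covered,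
  one-sidedly.\<close>

lemma integral_has_real_derivative_Ici:
  fixes g :: "real \<Rightarrow> real"
  assumes "continuous_on {0..} g" "0 \<le> t"
  shows "((\<lambda>t. integral {0..t} g) has_real_derivative g t) (at t within {0..})"
proof -
  have "((\<lambda>t. integral {0..t} g) has_real_derivative g t) (at t within {0..t + 1})"
    using assms by (intro integral_has_real_derivative continuous_on_subset[OF assms(1)]) auto
  moreover have "at t within {0..} = at t within {0..t + 1}"
    using assms(2) by (intro at_within_nhd[of _ "{..<t + 1}"]) auto
  ultimately show ?thesis by simp
qed

text \<open>The constants \<open>B\<close> and \<open>L\<close> are common to all indices, whereas
  no bound is placed on \<open>c\<close>. Finiteness of \<open>S i\<close> makes coordinatewise
  continuity enough for continuity of \<open>F i\<close> along a curve, so no topology on the full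
  state space is required.\<close>

locale local_lipschitz_system =
  fixes A :: "'i set" and F :: "'i \<Rightarrow> ('i \<Rightarrow> real) \<Rightarrow> real" and S :: "'i \<Rightarrow> 'i set"
    and B L :: real and u0 c :: "'i \<Rightarrow> real"
  assumes F_bound: "i \<in> A \<Longrightarrow> \<bar>F i u\<bar> \<le> B"
    and F_lipschitz: "i \<in> A \<Longrightarrow> 0 < \<delta> \<Longrightarrow> (\<And>j. j \<in> S i \<Longrightarrow> \<bar>u j - v j\<bar> \<le> \<delta>)
          \<Longrightarrow> \<bar>F i u - F i v\<bar> \<le> L * \<delta>"
    and S_subset: "i \<in> A \<Longrightarrow> S i \<subseteq> A"
    and S_finite: "i \<in> A \<Longrightarrow> finite (S i)"
    and B_pos: "0 < B" and L_pos: "0 < L"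
begin

lemma continuous_on_F:
  fixes v :: "real \<Rightarrow> 'i \<Rightarrow> real"
  assumes i: "i \<in> A" and v: "\<And>j. j \<in> A \<Longrightarrow> continuous_on T (\<lambda>t. v t j)"
  shows "continuous_on T (\<lambda>t. F i (v t))"
  unfolding continuous_on_def
proof (intro ballI tendstoI)
  fix x and e :: real assume x: "x \<in> T" and e: "0 < e"
  define \<delta> where "\<delta> = e / (2 * L)"
  have \<delta>: "0 < \<delta>" "L * \<delta> < e" using e L_pos by (auto simp: \<delta>_def)
  have "\<forall>\<^sub>F t in at x within T. \<forall>j\<in>S i. dist (v t j) (v x j) < \<delta>"
    using S_subset[OF i] v x \<delta>(1)
    by (intro eventually_ball_finite S_finite i ballI tendstoD) (auto simp: continuous_on_def)
  then show "\<forall>\<^sub>F t in at x within T. dist (F i (v t)) (F i (v x)) < e"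
  proof eventually_elim
    case (elim t)
    then have "\<bar>F i (v t) - F i (v x)\<bar> \<le> L * \<delta>"
      by (intro F_lipschitz i \<delta>) (auto simp: dist_real_def less_imp_le)
    then show ?case using \<delta> by (simp add: dist_real_def)
  qed
qed

text \<open>The iteration starts from \<open>u0 i + c i * t\<close> and not from
  \<open>u0 i\<close>: the first increment is then an integral of \<open>F\<close> alone, bounded by
  \<open>B * t\<close> for every index.\<close>

primrec picard_iterate :: "nat \<Rightarrow> real \<Rightarrow> 'i \<Rightarrow> real" where
  "picard_iterate 0 = (\<lambda>t i. u0 i + c i * t)"
| "picard_iterate (Suc n) =
    (\<lambda>t i. u0 i + c i * t + integral {0..t} (\<lambda>s. F i (picard_iterate n s)))"

lemma continuous_on_integral_F:
  fixes v :: "real \<Rightarrow> 'i \<Rightarrow> real"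
  assumes "i \<in> A" "\<And>j. j \<in> A \<Longrightarrow> continuous_on {0..} (\<lambda>t. v t j)"
  shows "continuous_on {0..} (\<lambda>t. integral {0..t} (\<lambda>s. F i (v s)))"
  using integral_has_real_derivative_Ici[OF continuous_on_F[OF assms]]
  by (intro DERIV_continuous_on) auto

lemma continuous_on_picard_iterate:
  "i \<in> A \<Longrightarrow> continuous_on {0..} (\<lambda>t. picard_iterate n t i)"
proof (induction n arbitrary: i)
  case 0
  then show ?case by (auto intro!: continuous_intros)
next
  case (Suc n)
  then show ?case
    by (auto intro!: continuous_intros continuous_on_integral_F)
qed

lemma F_integrable:
  fixes v :: "real \<Rightarrow> 'i \<Rightarrow> real"
  assumes "i \<in> A" "\<And>j. j \<in> A \<Longrightarrow> continuous_on {0..} (\<lambda>t. v t j)"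
  shows "(\<lambda>s. F i (v s)) integrable_on {0..t}"
  by (intro integrable_continuous_real continuous_on_subset[OF continuous_on_F[OF assms]]) auto

text \<open>Chosen so that the first increment obeys
  \<open>B * t = C * (2 * L * t) \<le> C * exp (2 * L * t)\<close>.\<close>

definition C :: real where "C = B / (2 * L)"

lemma C_pos: "0 < C"
  using B_pos L_pos by (simp add: C_def)

text \<open>The weight \<open>exp (2 * L * t)\<close> makes the Picard map a contraction with factor \<open>1/2\<close>, uniformly
  in the index.\<close>

lemma picard_iterate_step:
  assumes "i \<in> A" "0 \<le> t"
  shows "\<bar>picard_iterate (Suc n) t i - picard_iterate n t i\<bar> \<le> C * (1/2) ^ n * exp (2 * L * t)"
  using assms
proof (induction n arbitrary: i t)
  case 0
  have "continuous_on {0..t} (\<lambda>s. F i (picard_iterate 0 s))"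
    by (rule continuous_on_subset[of "{0..}"], rule continuous_on_F[OF 0(1)],
        rule continuous_on_picard_iterate) auto
  then have "norm (integral {0..t} (\<lambda>s. F i (picard_iterate 0 s))) \<le> B * (t - 0)"
    using 0 F_bound[OF 0(1)] by (intro integral_bound) (simp_all del: picard_iterate.simps)
  also have "\<dots> = C * (2 * L * t)"
    using L_pos by (simp add: C_def)
  also have "\<dots> \<le> C * exp (2 * L * t)"
    using C_pos exp_ge_add_one_self[of "2 * L * t"] by (intro mult_left_mono) linarith+
  finally show ?case by simp
next
  case (Suc n)
  let ?U = picard_iterate
  note cont = continuous_on_picard_iterate
  let ?h = "\<lambda>s. L * (C * (1/2) ^ n * exp (2 * L * s))"
  \<comment> \<open>Integrating \<open>L * exp (2 * L * s)\<close> produces the factor 1/2; the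
    subtracted boundary term at 0 is discarded later.\<close>
  have int: "(?h has_integral C * (1/2) ^ Suc n * exp (2 * L * t) - C * (1/2) ^ Suc n * exp (2 * L * 0)) {0..t}"
    using Suc.prems(2)
    by (intro fundamental_theorem_of_calculus)
      (auto intro!: derivative_eq_intros simp flip: has_real_derivative_iff_has_vector_derivative)
  have "?U (Suc (Suc n)) t i - ?U (Suc n) t i
      = integral {0..t} (\<lambda>s. F i (?U (Suc n) s) - F i (?U n s))"
    unfolding picard_iterate.simps(2)[of "Suc n"]
      picard_iterate.simps(2)[of n, THEN fun_cong, THEN fun_cong, of t i]
    by (subst integral_diff) (auto intro!: F_integrable cont Suc.prems(1) simp del: picard_iterate.simps)
  also have "\<bar>\<dots>\<bar> \<le> integral {0..t} ?h"
  proof -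
    have "norm (integral {0..t} (\<lambda>s. F i (?U (Suc n) s) - F i (?U n s))) \<le> integral {0..t} ?h"
    proof (rule integral_norm_bound_integral)
      fix s assume s: "s \<in> {0..t}"
      have "\<bar>F i (?U (Suc n) s) - F i (?U n s)\<bar> \<le> ?h s"
        using s C_pos S_subset[OF Suc.prems(1)]
        by (intro F_lipschitz Suc.prems(1) Suc.IH) auto
      then show "norm (F i (?U (Suc n) s) - F i (?U n s)) \<le> ?h s" by simp
    qed (use int in \<open>auto intro!: integrable_diff F_integrable cont Suc.prems(1) simp del: picard_iterate.simps
      simp: has_integral_integrable\<close>)
    then show ?thesis by simp
  qed
  also have "\<dots> \<le> C * (1/2) ^ Suc n * exp (2 * L * t)"
    using C_pos integral_unique[OF int] by simp
  finally show ?case .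
qed

text \<open>Telescoping. The coefficient is the exact partial sum of the powers of 1/2 from exponent
  \<open>n\<close> to \<open>n + k - 1\<close>, which lets the induction close without loss.\<close>

lemma picard_iterate_diff:
  assumes "i \<in> A" "0 \<le> t"
  shows "\<bar>picard_iterate (n + k) t i - picard_iterate n t i\<bar>
    \<le> (2 * (1/2) ^ n - 2 * (1/2) ^ (n + k)) * (C * exp (2 * L * t))"
proof (induction k)
  case (Suc k)
  have "\<bar>picard_iterate (n + Suc k) t i - picard_iterate (n + k) t i\<bar>
      \<le> (1/2) ^ (n + k) * (C * exp (2 * L * t))"
    using picard_iterate_step[OF assms, of "n + k"] by (simp add: mult_ac del: picard_iterate.simps)
  moreover have "(2 * (1/2) ^ n - 2 * (1/2) ^ (n + Suc k)) * (C * exp (2 * L * t))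
      = (2 * (1/2) ^ n - 2 * (1/2) ^ (n + k)) * (C * exp (2 * L * t))
        + (1/2) ^ (n + k) * (C * exp (2 * L * t))"
    by (simp add: algebra_simps)
  ultimately show ?case using Suc by linarith
qed simp

text \<open>The tail of the geometric series. It does not mention the index and grows with
  \<open>t\<close>, so it controls all coordinates at once on each bounded time interval.\<close>

definition rate :: "real \<Rightarrow> nat \<Rightarrow> real" where
  "rate t n = 2 * (1/2) ^ n * (C * exp (2 * L * t))"

lemma rate_pos: "0 < rate t n"
  using C_pos by (simp add: rate_def)

lemma rate_mono: "s \<le> t \<Longrightarrow> rate s n \<le> rate t n"
  using C_pos L_pos by (simp add: rate_def)

lemma rate_tendsto: "rate t \<longlonglongrightarrow> 0"
  unfolding rate_def
  by (intro tendsto_mult_left_zero tendsto_mult_right_zero LIMSEQ_power_zero) auto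

lemma picard_iterate_rate:
  assumes "i \<in> A" "0 \<le> t" "n \<le> m"
  shows "\<bar>picard_iterate m t i - picard_iterate n t i\<bar> \<le> rate t n"
proof -
  have "(2 * (1/2) ^ n - 2 * (1/2) ^ m) * (C * exp (2 * L * t)) \<le> rate t n"
    unfolding rate_def using C_pos by (intro mult_right_mono) auto
  then show ?thesis
    using picard_iterate_diff[OF assms(1,2), of n "m - n"] assms(3) by simp
qed

definition solution :: "real \<Rightarrow> 'i \<Rightarrow> real" where
  "solution t i = lim (\<lambda>n. picard_iterate n t i)"

lemma picard_iterate_tendsto:
  assumes "i \<in> A" "0 \<le> t"
  shows "(\<lambda>n. picard_iterate n t i) \<longlonglongrightarrow> solution t i"
proof -
  have "Cauchy (\<lambda>n. picard_iterate n t i)"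
  proof (rule metric_CauchyI)
    fix e :: real assume "0 < e"
    then have "\<forall>\<^sub>F n in sequentially. rate t n < e / 2"
      by (intro order_tendstoD(2)[OF rate_tendsto]) simp
    then obtain N where N: "rate t N < e / 2"
      by (auto simp: eventually_sequentially)
    have "dist (picard_iterate m t i) (picard_iterate n t i) < e" if "N \<le> m" "N \<le> n" for m n
      using picard_iterate_rate[OF assms that(1)] picard_iterate_rate[OF assms that(2)] N
      by (simp add: dist_real_def)
    then show "\<exists>M. \<forall>m\<ge>M. \<forall>n\<ge>M. dist (picard_iterate m t i) (picard_iterate n t i) < e"
      by blast
  qed
  then show ?thesis
    unfolding solution_def by (simp add: Cauchy_convergent_iff convergent_LIMSEQ_iff)
qed

lemma solution_rate:
  assumes "i \<in> A" "0 \<le> t"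
  shows "\<bar>solution t i - picard_iterate n t i\<bar> \<le> rate t n"
proof (rule tendsto_upperbound)
  show "(\<lambda>m. \<bar>picard_iterate m t i - picard_iterate n t i\<bar>)
      \<longlonglongrightarrow> \<bar>solution t i - picard_iterate n t i\<bar>"
    by (intro tendsto_intros picard_iterate_tendsto assms)
  show "\<forall>\<^sub>F m in sequentially. \<bar>picard_iterate m t i - picard_iterate n t i\<bar> \<le> rate t n"
    using picard_iterate_rate[OF assms] by (auto simp: eventually_sequentially)
qed simp

lemma solution_0: "solution 0 i = u0 i"
proof -
  have "picard_iterate n 0 i = u0 i" for n by (cases n) auto
  then show ?thesis by (simp add: solution_def)
qed

text \<open>Convergence is known to be uniform only on bounded intervals, since \<open>rate\<close>
  grows in time. Continuity being local, \<open>{0..t + 1}\<close> is enough at the point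
  \<open>t\<close>.\<close>

lemma continuous_on_solution:
  assumes i: "i \<in> A"
  shows "continuous_on {0..} (\<lambda>t. solution t i)"
proof -
  have cont: "continuous_on {0..T} (\<lambda>t. solution t i)" for T
  proof (rule uniform_limit_theorem)
    show "uniform_limit {0..T} (\<lambda>n t. picard_iterate n t i) (\<lambda>t. solution t i) sequentially"
    proof (rule uniform_limitI)
      fix e :: real assume "0 < e"
      then have "\<forall>\<^sub>F n in sequentially. rate T n < e"
        by (intro order_tendstoD(2)[OF rate_tendsto]) simp
      then show "\<forall>\<^sub>F n in sequentially. \<forall>t\<in>{0..T}. dist (picard_iterate n t i) (solution t i) < e"
      proof eventually_elim
        case (elim n)
        show ?case
        proof
          fix t assume "t \<in> {0..T}"
          then show "dist (picard_iterate n t i) (solution t i) < e"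
            using solution_rate[OF i, of t n] rate_mono[of t T n] elim
            by (simp add: dist_real_def abs_minus_commute)
        qed
      qed
    qed
  qed (auto intro!: always_eventually continuous_on_subset[OF continuous_on_picard_iterate[OF i]])
  show ?thesis
    unfolding continuous_on_def
  proof
    fix t :: real assume t: "t \<in> {0..}"
    then have "at t within {0..} = at t within {0..t + 1}"
      by (intro at_within_nhd[of _ "{..<t + 1}"]) auto
    then show "((\<lambda>t. solution t i) \<longlongrightarrow> solution t i) (at t within {0..})"
      using cont[of "t + 1"] t by (simp add: continuous_on_def)
  qed
qed

text \<open>The limit passes under the integral because \<open>rate t n\<close> bounds the error
  simultaneously for all coordinates in \<open>S i\<close> and all times up to
  \<open>t\<close>.\<close>

lemma solution_integral_equation:
  assumes i: "i \<in> A" and t: "0 \<le> t"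
  shows "solution t i = u0 i + c i * t + integral {0..t} (\<lambda>s. F i (solution s))"
proof (rule LIMSEQ_unique)
  show "(\<lambda>n. picard_iterate (Suc n) t i) \<longlonglongrightarrow> solution t i"
    by (rule LIMSEQ_Suc[OF picard_iterate_tendsto[OF assms]])
  have "(\<lambda>n. integral {0..t} (\<lambda>s. F i (picard_iterate n s)))
      \<longlonglongrightarrow> integral {0..t} (\<lambda>s. F i (solution s))"
  proof (rule LIM_zero_cancel, rule Lim_null_comparison)
    show "(\<lambda>n. L * rate t n * t) \<longlonglongrightarrow> 0"
      by (intro tendsto_mult_left_zero tendsto_mult_right_zero rate_tendsto)
    have "norm (integral {0..t} (\<lambda>s. F i (picard_iterate n s)) - integral {0..t} (\<lambda>s. F i (solution s)))
        \<le> L * rate t n * t" for n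
    proof -
      have "norm (integral {0..t} (\<lambda>s. F i (picard_iterate n s) - F i (solution s)))
          \<le> L * rate t n * (t - 0)"
      proof (rule integral_bound[OF t])
        show "continuous_on {0..t} (\<lambda>s. F i (picard_iterate n s) - F i (solution s))"
          by (rule continuous_on_subset[of "{0..}"])
            (auto intro!: continuous_on_diff continuous_on_F i continuous_on_picard_iterate
              continuous_on_solution simp del: picard_iterate.simps)
        fix s assume s: "s \<in> {0..t}"
        have "\<bar>F i (picard_iterate n s) - F i (solution s)\<bar> \<le> L * rate t n"
        proof (rule F_lipschitz[OF i rate_pos])
          fix j assume "j \<in> S i"
          then show "\<bar>picard_iterate n s j - solution s j\<bar> \<le> rate t n"
            using S_subset[OF i] s solution_rate[of j s n] rate_mono[of s t n]
            by (auto simp: abs_minus_commute)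
        qed
        then show "norm (F i (picard_iterate n s) - F i (solution s)) \<le> L * rate t n" by simp
      qed
      then show ?thesis
        using i by (simp add: integral_diff F_integrable continuous_on_picard_iterate
            continuous_on_solution)
    qed
    then show "\<forall>\<^sub>F n in sequentially. norm (integral {0..t} (\<lambda>s. F i (picard_iterate n s))
        - integral {0..t} (\<lambda>s. F i (solution s))) \<le> L * rate t n * t"
      by simp
  qed
  then show "(\<lambda>n. picard_iterate (Suc n) t i)
      \<longlonglongrightarrow> u0 i + c i * t + integral {0..t} (\<lambda>s. F i (solution s))"
    by (auto intro!: tendsto_intros)
qed

lemma solution_has_derivative:
  assumes i: "i \<in> A" and t: "0 < t"
  shows "((\<lambda>t. solution t i) has_real_derivative c i + F i (solution t)) (at t)"
proof -
  have "((\<lambda>t. u0 i + c i * t + integral {0..t} (\<lambda>s. F i (solution s)))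
      has_real_derivative c i + F i (solution t)) (at t within {0..})"
    using t by (auto intro!: derivative_eq_intros integral_has_real_derivative_Ici
        continuous_on_F i continuous_on_solution)
  then have "((\<lambda>t. solution t i) has_real_derivative c i + F i (solution t)) (at t within {0..})"
    using solution_integral_equation[OF i] t
    by (elim has_field_derivative_transform_within[where d = 1]) auto
  moreover have "at t within {0..} = at t"
    using t by (intro at_within_interior) (simp add: interior_real_atLeast)
  ultimately show ?thesis by simp
qed

end

section \<open>Regularity\<close>

lemma lipschitz_on_deriv_bound:
  fixes f :: "real \<Rightarrow> real"
  assumes "convex S" "\<And>t. t \<in> S \<Longrightarrow> (f has_real_derivative f' t) (at t)"
    and "\<And>t. t \<in> S \<Longrightarrow> \<bar>f' t\<bar> \<le> K" "0 \<le> K"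
  shows "K-lipschitz_on S f"
proof (rule lipschitz_onI)
  fix s t assume "s \<in> S" "t \<in> S"
  then have "norm (f s - f t) \<le> K * norm (s - t)"
    using assms by (intro field_differentiable_bound[of S f f'])
      (simp_all add: has_field_derivative_at_within)
  then show "dist (f s) (f t) \<le> K * dist s t"
    by (simp add: dist_norm)
qed (rule assms)

lemma lipschitz_on_mult_bounded:
  fixes f g :: "real \<Rightarrow> real"
  assumes "L-lipschitz_on S f" "M-lipschitz_on S g"
    and "\<And>t. t \<in> S \<Longrightarrow> \<bar>f t\<bar> \<le> P" "\<And>t. t \<in> S \<Longrightarrow> \<bar>g t\<bar> \<le> Q" "0 \<le> P" "0 \<le> Q"
  shows "(P * M + Q * L)-lipschitz_on S (\<lambda>t. f t * g t)"
proof (rule lipschitz_onI)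
  fix s t assume st: "s \<in> S" "t \<in> S"
  have "\<bar>f s * (g s - g t)\<bar> \<le> P * (M * \<bar>s - t\<bar>)"
    unfolding abs_mult using assms st lipschitz_onD[OF assms(2) st]
    by (intro mult_mono) (auto simp: dist_real_def)
  moreover have "\<bar>g t * (f s - f t)\<bar> \<le> Q * (L * \<bar>s - t\<bar>)"
    unfolding abs_mult using assms st lipschitz_onD[OF assms(1) st]
    by (intro mult_mono) (auto simp: dist_real_def)
  moreover have "f s * g s - f t * g t = f s * (g s - g t) + g t * (f s - f t)"
    by (simp add: algebra_simps)
  ultimately show "dist (f s * g s) (f t * g t) \<le> (P * M + Q * L) * dist s t"
    by (simp add: dist_real_def algebra_simps)
qed (use assms(5,6) lipschitz_on_nonneg[OF assms(1)] lipschitz_on_nonneg[OF assms(2)] in simp)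

lemma C11_posI:
  assumes f: "\<And>t. 0 < t \<Longrightarrow> (f has_real_derivative f' t) (at t)"
    and lip: "\<And>T. 0 < T \<Longrightarrow> \<exists>L. L-lipschitz_on {0<..T} f'"
  shows "C11_pos f"
proof -
  have deriv: "deriv f t = f' t" if "0 < t" for t
    using f[OF that] by (rule DERIV_imp_deriv)
  have lip': "\<exists>L. L-lipschitz_on {0<..T} (deriv f)" if T: "0 < T" for T
  proof -
    from lip[OF T] obtain L where "L-lipschitz_on {0<..T} f'" ..
    then have "L-lipschitz_on {0<..T} (deriv f)"
      by (rule lipschitz_on_transform) (simp add: deriv)
    then show ?thesis ..
  qed
  have "isCont (deriv f) t" if t: "t \<in> {0<..}" for t
  proof -
    have "\<exists>L. L-lipschitz_on {0<..t + 1} (deriv f)" using lip' t by simp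
    then obtain L where "L-lipschitz_on {0<..t + 1} (deriv f)" ..
    then have "continuous_on {0<..<t + 1} (deriv f)"
      by (rule continuous_on_subset[OF lipschitz_on_continuous_on]) auto
    then show ?thesis
      by (rule continuous_on_interior) (use t in \<open>simp add: interior_open\<close>)
  qed
  then have "continuous_on {0<..} (deriv f)"
    by (intro continuous_at_imp_continuous_on ballI)
  moreover have "f field_differentiable at t" if "0 < t" for t
    using f[OF that] unfolding field_differentiable_def ..
  ultimately show ?thesis
    using lip' by (simp add: C11_pos_def)
qed

text \<open>Finite-order differentiability on the positive half-line with a derivative supplied as a
  witness, so that the calculus rules follow by induction without computing iterated
  \<open>deriv\<close>. Order 0 demands nothing, which gives the bootstrap a trivial start.\<close>

primrec n_differentiable :: "nat \<Rightarrow> (real \<Rightarrow> real) \<Rightarrow> bool" where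
  "n_differentiable 0 f = True"
| "n_differentiable (Suc n) f =
    (\<exists>f'. (\<forall>t>0. (f has_real_derivative f' t) (at t)) \<and> n_differentiable n f')"

lemma n_differentiable_SucI:
  assumes "\<And>t. 0 < t \<Longrightarrow> (f has_real_derivative f' t) (at t)" "n_differentiable n f'"
  shows "n_differentiable (Suc n) f"
  unfolding n_differentiable.simps using assms by (intro exI[of _ f']) simp

lemma n_differentiable_SucD:
  "n_differentiable (Suc n) f \<Longrightarrow>
    \<exists>f'. (\<forall>t. 0 < t \<longrightarrow> (f has_real_derivative f' t) (at t)) \<and> n_differentiable n f'"
  by simp

declare n_differentiable.simps(2) [simp del]

lemma n_differentiable_cong:
  assumes "n_differentiable n f" "\<And>t. 0 < t \<Longrightarrow> f t = g t"
  shows "n_differentiable n g"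
proof (cases n)
  case (Suc m)
  with assms(1) obtain f' where f':
      "\<And>t. 0 < t \<Longrightarrow> (f has_real_derivative f' t) (at t)" "n_differentiable m f'"
    using n_differentiable_SucD[of m f] by auto
  have "(g has_real_derivative f' t) (at t)" if "0 < t" for t
    by (rule has_field_derivative_transform_within_open[OF f'(1)[OF that], of "{0<..}"])
      (simp_all add: that assms(2))
  then show ?thesis unfolding Suc using f'(2) by (rule n_differentiable_SucI)
qed simp

text \<open>In the product and quotient rules the undifferentiated factors reappear and are needed
  at the lower order.\<close>

lemma n_differentiable_Suc_imp: "n_differentiable (Suc n) f \<Longrightarrow> n_differentiable n f"
proof (induction n arbitrary: f)
  case (Suc n)
  obtain f' where f': "\<And>t. 0 < t \<Longrightarrow> (f has_real_derivative f' t) (at t)"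
      "n_differentiable (Suc n) f'"
    using n_differentiable_SucD[OF Suc.prems] by auto
  from f'(1) Suc.IH[OF f'(2)] show ?case by (rule n_differentiable_SucI)
qed simp

lemma n_differentiable_const: "n_differentiable n (\<lambda>_. c)"
proof (induction n arbitrary: c)
  case (Suc n)
  show ?case by (rule n_differentiable_SucI[OF _ Suc.IH[of 0]]) simp
qed simp

lemma n_differentiable_add:
  "n_differentiable n f \<Longrightarrow> n_differentiable n g \<Longrightarrow> n_differentiable n (\<lambda>t. f t + g t)"
proof (induction n arbitrary: f g)
  case (Suc n)
  obtain f' where f': "\<And>t. 0 < t \<Longrightarrow> (f has_real_derivative f' t) (at t)" "n_differentiable n f'"
    using n_differentiable_SucD[OF Suc.prems(1)] by auto
  obtain g' where g': "\<And>t. 0 < t \<Longrightarrow> (g has_real_derivative g' t) (at t)" "n_differentiable n g'"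
    using n_differentiable_SucD[OF Suc.prems(2)] by auto
  show ?case
    by (rule n_differentiable_SucI[OF DERIV_add Suc.IH]) (fact f' g')+
qed simp

lemma n_differentiable_mult:
  "n_differentiable n f \<Longrightarrow> n_differentiable n g \<Longrightarrow> n_differentiable n (\<lambda>t. f t * g t)"
proof (induction n arbitrary: f g)
  case (Suc n)
  obtain f' where f': "\<And>t. 0 < t \<Longrightarrow> (f has_real_derivative f' t) (at t)" "n_differentiable n f'"
    using n_differentiable_SucD[OF Suc.prems(1)] by auto
  obtain g' where g': "\<And>t. 0 < t \<Longrightarrow> (g has_real_derivative g' t) (at t)" "n_differentiable n g'"
    using n_differentiable_SucD[OF Suc.prems(2)] by auto
  note fg = Suc.prems[THEN n_differentiable_Suc_imp]
  have "n_differentiable n (\<lambda>t. f' t * g t + g' t * f t)"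
    by (intro n_differentiable_add Suc.IH fg f' g')
  with DERIV_mult[OF f'(1) g'(1)] show ?case
    by (rule n_differentiable_SucI)
qed simp

lemma n_differentiable_inverse:
  "n_differentiable n f \<Longrightarrow> (\<And>t. 0 < t \<Longrightarrow> f t \<noteq> 0) \<Longrightarrow> n_differentiable n (\<lambda>t. 1 / f t)"
proof (induction n arbitrary: f)
  case (Suc n)
  obtain f' where f': "\<And>t. 0 < t \<Longrightarrow> (f has_real_derivative f' t) (at t)" "n_differentiable n f'"
    using n_differentiable_SucD[OF Suc.prems(1)] by auto
  have "n_differentiable n (\<lambda>t. 1 / f t)"
    using Suc.IH[OF n_differentiable_Suc_imp[OF Suc.prems(1)] Suc.prems(2)] .
  then have "n_differentiable n (\<lambda>t. (- 1 * f' t) * ((1 / f t) * (1 / f t)))"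
    using f'(2) by (intro n_differentiable_mult n_differentiable_const)
  moreover have "((\<lambda>t. 1 / f t) has_real_derivative (- 1 * f' t) * ((1 / f t) * (1 / f t))) (at t)"
    if "0 < t" for t
    using DERIV_divide[OF DERIV_const f'(1)[OF that] Suc.prems(2)[OF that], of 1] by simp
  ultimately show ?case
    by (intro n_differentiable_SucI)
qed simp

lemma n_differentiable_sum:
  "(\<And>i. i \<in> I \<Longrightarrow> n_differentiable n (f i)) \<Longrightarrow> n_differentiable n (\<lambda>t. \<Sum>i\<in>I. f i t)"
  by (induction I rule: infinite_finite_induct)
    (simp_all add: n_differentiable_const n_differentiable_add)

lemma smooth_posI:
  assumes "\<And>n. n_differentiable n f"
  shows "smooth_pos f"
proof -
  have deriv: "n_differentiable n (deriv g)" if g: "n_differentiable (Suc n) g" for n g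
  proof -
    obtain g' where g': "\<And>t. 0 < t \<Longrightarrow> (g has_real_derivative g' t) (at t)" "n_differentiable n g'"
      using n_differentiable_SucD[OF g] by auto
    show ?thesis
      by (rule n_differentiable_cong[OF g'(2)]) (simp add: DERIV_imp_deriv[OF g'(1)])
  qed
  have *: "n_differentiable n ((deriv ^^ m) f)" for m n
    by (induction m arbitrary: n) (simp_all add: assms deriv)
  have "((deriv ^^ m) f) field_differentiable (at t)" if "0 < t" for m t
    using n_differentiable_SucD[OF *[of "Suc 0" m]] that by (auto simp: field_differentiable_def)
  then show ?thesis by (simp add: smooth_pos_def)
qed

section \<open>Regularity of the solution and its exponential\<close>

context local_lipschitz_system
begin

lemma solution_lipschitz:
  assumes "i \<in> A"
  shows "(\<bar>c i\<bar> + B)-lipschitz_on {0<..} (\<lambda>t. solution t i)"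
proof (rule lipschitz_on_deriv_bound[OF _ solution_has_derivative[OF assms]])
  show "\<bar>c i + F i (solution t)\<bar> \<le> \<bar>c i\<bar> + B" for t
    using F_bound[OF assms, of "solution t"] by linarith
qed (use B_pos in simp_all)

lemma F_solution_lipschitz:
  assumes i: "i \<in> A"
  shows "\<exists>M. M-lipschitz_on {0<..} (\<lambda>t. c i + F i (solution t))"
proof
  \<comment> \<open>A common Lipschitz constant for the finitely many coordinates seen by
    \<open>F i\<close>. The summand 1 keeps it positive even for an empty sum, because
    \<open>F_lipschitz\<close> asks for a positive \<delta>; the case \<open>s = t\<close> is split
    off for the same reason.\<close>
  define M where "M = (\<Sum>j\<in>S i. \<bar>c j\<bar> + B) + 1"
  have "0 \<le> (\<Sum>j\<in>S i. \<bar>c j\<bar> + B)" using B_pos by (intro sum_nonneg) simp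
  then have M: "0 < M" by (simp add: M_def)
  show "(L * M)-lipschitz_on {0<..} (\<lambda>t. c i + F i (solution t))"
  proof (rule lipschitz_onI)
    fix s t :: real assume st: "s \<in> {0<..}" "t \<in> {0<..}"
    show "dist (c i + F i (solution s)) (c i + F i (solution t)) \<le> L * M * dist s t"
    proof (cases "s = t")
      case False
      have "\<bar>F i (solution s) - F i (solution t)\<bar> \<le> L * (M * \<bar>s - t\<bar>)"
      proof (rule F_lipschitz[OF i])
        fix j assume j: "j \<in> S i"
        have "dist (solution s j) (solution t j) \<le> (\<bar>c j\<bar> + B) * dist s t"
          using lipschitz_onD[OF solution_lipschitz st] S_subset[OF i] j by blast
        also have "\<dots> \<le> M * dist s t"
        proof (rule mult_right_mono)
          have "\<bar>c j\<bar> + B \<le> (\<Sum>j\<in>S i. \<bar>c j\<bar> + B)"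
            using j B_pos by (intro member_le_sum S_finite i) auto
          then show "\<bar>c j\<bar> + B \<le> M" by (simp add: M_def)
        qed simp
        finally show "\<bar>solution s j - solution t j\<bar> \<le> M * \<bar>s - t\<bar>"
          by (simp add: dist_real_def)
      qed (use False M in simp)
      then show ?thesis by (simp add: dist_real_def mult.assoc)
    qed simp
  qed (use L_pos M in simp)
qed

lemma exp_solution_has_derivative:
  assumes "i \<in> A" "0 < t"
  shows "((\<lambda>t. exp (solution t i)) has_real_derivative
    (c i + F i (solution t)) * exp (solution t i)) (at t)"
  using DERIV_chain2[OF DERIV_exp solution_has_derivative[OF assms]] by (simp add: mult.commute)

lemma C11_pos_exp_solution:
  assumes i: "i \<in> A"
  shows "C11_pos (\<lambda>t. exp (solution t i))"
proof (rule C11_posI[OF exp_solution_has_derivative[OF i]])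
  fix T :: real assume "0 < T"
  let ?K = "\<bar>c i\<bar> + B"
  \<comment> \<open>The exponential is bounded here through compactness, only on bounded intervals;
    closing the interval at 0 uses continuity up to the initial time.\<close>
  have "continuous_on {0..T} (\<lambda>t. exp (solution t i))"
    by (rule continuous_on_subset[of "{0..}"])
      (auto intro!: continuous_intros continuous_on_solution i)
  then have "bounded ((\<lambda>t. exp (solution t i)) ` {0..T})"
    by (intro compact_imp_bounded compact_continuous_image) auto
  then obtain Q where "\<forall>z \<in> (\<lambda>t. exp (solution t i)) ` {0..T}. norm z \<le> Q"
    unfolding bounded_iff ..
  then have Q: "\<bar>exp (solution t i)\<bar> \<le> Q" if "t \<in> {0..T}" for t
    using that by simp
  have K: "\<bar>c i + F i (solution t)\<bar> \<le> ?K" for t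
    using F_bound[OF i, of "solution t"] by linarith
  have Q0: "0 \<le> Q" using order_trans[OF abs_ge_zero Q[of 0]] \<open>0 < T\<close> by simp
  have K0: "0 \<le> ?K" using B_pos by simp
  have exp_lip: "(?K * Q)-lipschitz_on {0<..T} (\<lambda>t. exp (solution t i))"
  proof (rule lipschitz_on_deriv_bound[OF _ exp_solution_has_derivative[OF i]])
    fix t assume "t \<in> {0<..T}"
    then show "\<bar>(c i + F i (solution t)) * exp (solution t i)\<bar> \<le> ?K * Q"
      unfolding abs_mult using K Q[of t] K0 by (intro mult_mono) auto
  qed (use K0 Q0 in auto)
  obtain M where "M-lipschitz_on {0<..} (\<lambda>t. c i + F i (solution t))"
    using F_solution_lipschitz[OF i] by blast
  then have "M-lipschitz_on {0<..T} (\<lambda>t. c i + F i (solution t))"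
    by (rule lipschitz_on_subset) auto
  from lipschitz_on_mult_bounded[OF this exp_lip, of ?K Q] K Q K0 Q0
  show "\<exists>L. L-lipschitz_on {0<..T} (\<lambda>t. (c i + F i (solution t)) * exp (solution t i))"
    by (intro exI) auto
qed

end

section \<open>The Ricci flow\<close>

context connected_lf_graph
begin

lemma edge_ends: "e \<in> E \<Longrightarrow> \<exists>x y. e = {x, y}"
  using simple unfolding simple_graph_def card_2_iff by blast

text \<open>The system is indexed by unordered edges while the curvature takes ordered endpoints. An
  arbitrary orientation is fixed; \<open>edge_speed_eq\<close> shows by symmetry that the choice is
  immaterial.\<close>

definition end1 :: "'a set \<Rightarrow> 'a" where "end1 e = (SOME x. \<exists>y. e = {x, y})"
definition end2 :: "'a set \<Rightarrow> 'a" where "end2 e = (SOME y. e = {end1 e, y})"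

lemma ends_eq: "e \<in> E \<Longrightarrow> {end1 e, end2 e} = e"
proof -
  assume "e \<in> E"
  then have "\<exists>y. e = {end1 e, y}"
    unfolding end1_def by (rule someI_ex[OF edge_ends])
  then have "e = {end1 e, end2 e}"
    unfolding end2_def by (rule someI_ex)
  then show ?thesis by simp
qed

lemma ends_edge: "e \<in> E \<Longrightarrow> {end1 e, end2 e} \<in> E" "e \<in> E \<Longrightarrow> {end2 e, end1 e} \<in> E"
  using ends_eq by (simp_all add: insert_commute)

definition edge_speed :: "'a set \<Rightarrow> ('a set \<Rightarrow> real) \<Rightarrow> real" where
  "edge_speed e u = - lly_curvature E (\<lambda>e. exp (u e)) (end1 e) (end2 e)"

lemma edge_speed_eq: "{x, y} \<in> E \<Longrightarrow> edge_speed {x, y} u = - lly_curvature E (\<lambda>e. exp (u e)) x y"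
  using ends_eq[of "{x, y}"] lly_curvature_commute
  by (auto simp: edge_speed_def doubleton_eq_iff)

definition adjacent_edges :: "'a set \<Rightarrow> 'a set set" where
  "adjacent_edges e = (\<lambda>z. {end1 e, z}) ` nbrs E (end1 e) \<union> (\<lambda>z. {end2 e, z}) ` nbrs E (end2 e)"

lemma local_lipschitz_system_edges:
  "local_lipschitz_system E edge_speed adjacent_edges 2 8"
proof
  fix e u assume e: "e \<in> E"
  show "\<bar>edge_speed e u\<bar> \<le> 2"
    using lly_curvature_bound[of "\<lambda>e. exp (u e)", OF _ ends_edge(1)[OF e]]
    by (simp add: edge_speed_def)
  show "adjacent_edges e \<subseteq> E"
    by (auto simp: adjacent_edges_def nbrs_iff)
  show "finite (adjacent_edges e)"
    using edgeD[OF ends_edge(1)[OF e]] finite_nbrs by (simp add: adjacent_edges_def)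
next
  fix e u v and \<delta> :: real
  assume e: "e \<in> E" and \<delta>: "0 < \<delta>"
    and u: "\<And>j. j \<in> adjacent_edges e \<Longrightarrow> \<bar>u j - v j\<bar> \<le> \<delta>"
  have "\<bar>lly_curvature E (\<lambda>e. exp (u e)) (end1 e) (end2 e)
      - lly_curvature E (\<lambda>e. exp (v e)) (end1 e) (end2 e)\<bar> \<le> 8 * \<delta>"
    using u by (intro lly_curvature_exp_lipschitz ends_edge e \<delta>)
      (auto simp: adjacent_edges_def nbrs_iff)
  then show "\<bar>edge_speed e u - edge_speed e v\<bar> \<le> 8 * \<delta>"
    by (simp add: edge_speed_def)
qed auto

text \<open>Bootstrap over all edges at once: by the explicit curvature, the derivative at one edge
  is rational in the weights of finitely many edges with nonvanishing denominators, so order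
  \<open>n\<close> everywhere gives order \<open>Suc n\<close> there.\<close>

lemma n_differentiable_flow:
  assumes sol: "ricci_flow_solution E \<kappa>s \<omega>0 \<omega>" and girth: "6 \<le> girth E" and e: "e \<in> E"
  shows "n_differentiable n (\<lambda>t. \<omega> t e)"
  using e
proof (induction n arbitrary: e)
  case (Suc n)
  obtain x y where xy: "e = {x, y}" using edge_ends[OF Suc.prems] by blast
  then have edges: "{x, y} \<in> E" "{y, x} \<in> E" using Suc.prems by (simp_all add: insert_commute)
  have pos: "\<forall>e\<in>E. 0 < \<omega> t e" if "0 < t" for t
    using sol that by (simp add: ricci_flow_solution_def)
  let ?m = "\<lambda>x t. vertex_weight E (\<omega> t) x"
  have m: "n_differentiable n (\<lambda>t. 1 / ?m v t)" if v: "{v, z} \<in> E" for v z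
  proof (rule n_differentiable_inverse)
    show "n_differentiable n (?m v)"
      unfolding vertex_weight_def by (intro n_differentiable_sum Suc.IH) (simp add: nbrs_iff)
    show "?m v t \<noteq> 0" if "0 < t" for t
      using vertex_weight_pos[OF pos[OF that] v] by simp
  qed
  show ?case
  proof (rule n_differentiable_SucI)
    show "n_differentiable n
        (\<lambda>t. (\<kappa>s e + 2 + (- 2) * (\<omega> t e * (1 / ?m x t + 1 / ?m y t))) * \<omega> t e)"
      by (intro n_differentiable_mult n_differentiable_add n_differentiable_const
          m[OF edges(1)] m[OF edges(2)] Suc.IH Suc.prems)
    fix t :: real assume t: "0 < t"
    have "((\<lambda>t. \<omega> t {x, y}) has_real_derivative
        - (lly_curvature E (\<omega> t) x y - \<kappa>s {x, y}) * \<omega> t {x, y}) (at t)"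
      using sol t edges(1) by (simp add: ricci_flow_solution_def)
    then show "((\<lambda>t. \<omega> t e) has_real_derivative
        (\<kappa>s e + 2 + (- 2) * (\<omega> t e * (1 / ?m x t + 1 / ?m y t))) * \<omega> t e) (at t)"
      unfolding lly_curvature_girth_6[OF pos[OF t] girth edges(1)] xy
      by (simp add: mult.assoc diff_diff_eq2)
  qed
qed simp

end

theorem theorem1p1:
  fixes V :: "'a set" and E :: "'a set set"
    and \<kappa>s \<omega>0 :: "'a set \<Rightarrow> real"
  assumes "simple_graph V E"
    and "infinite V"
    and "connected_graph V E"
    and "locally_finite_graph V E"
    and "\<And>e. e \<in> E \<Longrightarrow> \<omega>0 e > 0"
  shows "\<exists>\<omega>. ricci_flow_solution E \<kappa>s \<omega>0 \<omega> \<and>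
           (\<forall>e\<in>E. C11_pos (\<lambda>t. \<omega> t e)) \<and>
           (girth E \<ge> 6 \<longrightarrow> (\<forall>e\<in>E. smooth_pos (\<lambda>t. \<omega> t e)))"
proof -
  interpret connected_lf_graph V E
    by standard (rule assms)+
  \<comment> \<open>The prescribed curvature enters as the linear drift \<open>c\<close>, outside
    \<open>F\<close>; 2 bounds the curvature and 8 is its Lipschitz constant.\<close>
  interpret local_lipschitz_system E edge_speed adjacent_edges 2 8 "\<lambda>e. ln (\<omega>0 e)" \<kappa>s
    by (rule local_lipschitz_system_edges)
  define \<omega> where "\<omega> t e = exp (solution t e)" for t e
  have deriv: "((\<lambda>s. \<omega> s {x, y}) has_real_derivative
      - (lly_curvature E (\<omega> t) x y - \<kappa>s {x, y}) * \<omega> t {x, y}) (at t)"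
    if "{x, y} \<in> E" "0 < t" for x y t
    using exp_solution_has_derivative[OF that] edge_speed_eq[OF that(1), of "solution t"]
    by (simp add: \<omega>_def[abs_def])
  have sol: "ricci_flow_solution E \<kappa>s \<omega>0 \<omega>"
    unfolding ricci_flow_solution_def using deriv
    by (auto simp: \<omega>_def solution_0 assms(5) intro!: continuous_on_exp continuous_on_solution)
  moreover have "\<forall>e\<in>E. C11_pos (\<lambda>t. \<omega> t e)"
    unfolding \<omega>_def using C11_pos_exp_solution by blast
  moreover have "\<forall>e\<in>E. smooth_pos (\<lambda>t. \<omega> t e)" if "6 \<le> girth E"
    using n_differentiable_flow[OF sol that] by (blast intro: smooth_posI)
  ultimately show ?thesis by blast
qed

end
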